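(* Let $d\in\{2,3\}$, let $\Omega\subset\mathbb{R}^d$ be a smooth, connected, bounded domain, and let $\gamma_1,\gamma_2,W\in C^\infty(\partial\Omega)$ with $\gamma_1,\gamma_2>0$. Suppose $(c_1^*,c_2^*,u^* )$, with corresponding potential $\Phi^*$ and pressure $p^*$, is a smooth solution of $$u^*\cdot\nabla c_1^*=\operatorname{div}(\nabla c_1^*+c_1^*\nabla\Phi^* ),\qquad u^*\cdot\nabla c_2^*=\operatorname{div}(\nabla c_2^*-c_2^*\nabla\Phi^* ),$$ $$-\Delta\Phi^*=c_1^*-c_2^*=\rho^*,\qquad u^*\cdot\nabla u^*-\Delta u^*+\nabla p^*=-\rho^*\nabla\Phi^*,\qquad \operatorname{div}u^*=0$$ in $\Omega$ with boundary conditions $c_i^*|_{\partial\Omega}=\gamma_i$ ($i=1,2$), $\Phi^*|_{\partial\Omega}=W$, $u^*|_{\partial\Omega}=0$. Suppose in addition that $$\int_{\partial\Omega}(\gamma_1-\gamma_2)(n_i\partial_j-n_j\partial_i)W\,dS\neq 0\quad\text{or}\quad \int_{\partial\Omega}W(n_i\partial_j-n_j\partial_i)(\gamma_1-\gamma_2)\,dS\neq 0$$ for some coordinate indices $i\neq j$. Then $u^*\not\equiv 0$.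
   Context: $n=(n_i)$ is the unit normal vector along $\partial\Omega$, and $i,j$ range over the coordinates ($\{x,y,z\}$ if $d=3$, $\{x,y\}$ if $d=2$). For $i\ne j$ the operator $n_i\partial_j-n_j\partial_i$ is differentiation along the vector field $n_ie_j-n_je_i$ (with $e_k$ the canonical basis of $\mathbb{R}^d$), which is tangent to $\partial\Omega$; hence it acts on functions defined only on $\partial\Omega$ and the integrals are well defined. $dS$ is the surface element. *)

theory Defs
  imports "HOL-Analysis.Analysis"
begin

text \<open>Differentiability classes on an open set \<open>V\<close>; for other sets these are not meaningful.\<close>

fun Ck_on :: "nat \<Rightarrow> 'a::real_normed_vector set \<Rightarrow> ('a \<Rightarrow> 'b::real_normed_vector) \<Rightarrow> bool" where
  "Ck_on 0 V f \<longleftrightarrow> continuous_on V f"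
| "Ck_on (Suc k) V f \<longleftrightarrow>
     (\<forall>x\<in>V. f differentiable (at x)) \<and> (\<forall>v. Ck_on k V (\<lambda>x. frechet_derivative f (at x) v))"

definition smooth_on :: "'a::real_normed_vector set \<Rightarrow> ('a \<Rightarrow> 'b::real_normed_vector) \<Rightarrow> bool" where
  "smooth_on V f \<longleftrightarrow> (\<forall>k. Ck_on k V f)"

text \<open>The space \<open>C\<^sup>\<infinity>(S)\<close> for a closed set \<open>S\<close>, here the closure or the boundary of a smooth bounded
  domain: restrictions to \<open>S\<close> of functions that are smooth on a neighbourhood of \<open>S\<close>.
  Values of \<open>f\<close> outside \<open>S\<close> play no role.\<close>

definition smooth_upto :: "'a::real_normed_vector set \<Rightarrow> ('a \<Rightarrow> 'b::real_normed_vector) \<Rightarrow> bool" where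
  "smooth_upto S f \<longleftrightarrow> (\<exists>V g. open V \<and> S \<subseteq> V \<and> smooth_on V g \<and> (\<forall>x\<in>S. g x = f x))"

text \<open>Near each boundary point, \<open>\<Omega>\<close> is the part of a ball strictly on one side (above for \<open>s = 1\<close>,
  below for \<open>s = -1\<close>) of the graph, over a coordinate hyperplane \<open>x\<^sub>k = 0\<close>, of a smooth function
  \<open>g\<close>. The function \<open>g\<close> of the remaining coordinates is given by its values on that hyperplane.\<close>

definition smooth_boundary :: "(real^'n) set \<Rightarrow> bool" where
  "smooth_boundary \<Omega> \<longleftrightarrow>
     (\<forall>p\<in>frontier \<Omega>. \<exists>r>0. \<exists>k. \<exists>s\<in>{-1, 1::real}. \<exists>g :: real^'n \<Rightarrow> real. smooth_on UNIV g \<and>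
        \<Omega> \<inter> ball p r = {x \<in> ball p r. s * (x $ k - g (\<chi> i. if i = k then 0 else x $ i)) > 0})"

definition smooth_bounded_domain :: "(real^'n) set \<Rightarrow> bool" where
  "smooth_bounded_domain \<Omega> \<longleftrightarrow>
     open \<Omega> \<and> connected \<Omega> \<and> \<Omega> \<noteq> {} \<and> bounded \<Omega> \<and> smooth_boundary \<Omega>"

definition tangent_space :: "(real^'n) set \<Rightarrow> real^'n \<Rightarrow> (real^'n) set" where
  "tangent_space S x =
     {v. \<exists>c :: real \<Rightarrow> real^'n. c 0 = x \<and> (\<forall>\<^sub>F t in nhds 0. c t \<in> S) \<and>
           (c has_vector_derivative v) (at 0)}"

definition unit_normal :: "(real^'n) set \<Rightarrow> real^'n \<Rightarrow> real^'n" where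
  "unit_normal \<Omega> x =
     (THE \<nu>. norm \<nu> = 1 \<and> (\<forall>v\<in>tangent_space (frontier \<Omega>) x. \<nu> \<bullet> v = 0) \<and>
        (\<forall>\<^sub>F t in at_right 0. x - t *\<^sub>R \<nu> \<in> \<Omega> \<and> x + t *\<^sub>R \<nu> \<notin> closure \<Omega>))"

text \<open>\<open>(n\<^sub>i \<partial>\<^sub>j - n\<^sub>j \<partial>\<^sub>i) f\<close>, the derivative along the tangent field \<open>n\<^sub>i e\<^sub>j - n\<^sub>j e\<^sub>i\<close>, of a function on
  the boundary. The derivative of \<open>f\<close> relative to \<open>frontier \<Omega>\<close> is not unique as a linear map on
  \<open>\<real>\<^sup>d\<close>, but its values on tangent vectors are, and they depend only on \<open>f\<close> on the boundary.\<close>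

definition tangential_deriv ::
    "(real^'n) set \<Rightarrow> 'n \<Rightarrow> 'n \<Rightarrow> (real^'n \<Rightarrow> real) \<Rightarrow> real^'n \<Rightarrow> real" where
  "tangential_deriv \<Omega> i j f x =
     frechet_derivative f (at x within frontier \<Omega>)
       (unit_normal \<Omega> x $ i *\<^sub>R axis j 1 - unit_normal \<Omega> x $ j *\<^sub>R axis i 1)"

text \<open>Local parametrizations of a hypersurface \<open>S\<close> in \<open>\<real>\<^sup>n\<close>, the parameter domains being open in
  \<open>\<real>\<^sup>m\<close> with \<open>m = n - 1\<close>.\<close>

definition local_parametrizations ::
    "(real^'n) set \<Rightarrow> ((real^'m) set \<times> (real^'m \<Rightarrow> real^'n)) set" where
  "local_parametrizations S =
     {(U, \<phi>). open U \<and> smooth_on U \<phi> \<and> (\<forall>u\<in>U. inj (frechet_derivative \<phi> (at u))) \<and>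
        (\<exists>\<psi>. homeomorphism U (\<phi> ` U) \<phi> \<psi>) \<and> openin (top_of_set S) (\<phi> ` U)}"

definition surface_element :: "(real^'m \<Rightarrow> real^'n) \<Rightarrow> real^'m \<Rightarrow> real" where
  "surface_element \<phi> u =
     sqrt (det (transpose (jacobian \<phi> (at u)) ** jacobian \<phi> (at u)))"

definition patch_measure :: "(real^'m) set \<Rightarrow> (real^'m \<Rightarrow> real^'n) \<Rightarrow> (real^'n) measure" where
  "patch_measure U \<phi> =
     distr (density (restrict_space lborel U) (\<lambda>u. ennreal (surface_element \<phi> u))) borel \<phi>"

text \<open>The measure \<open>dS\<close>. By the change of variables formula, any two patch measures agree on the
  overlap of the two patches, so their supremum in the lattice of measures is the measure on \<open>S\<close>
  that restricts to the patch measure on every patch. The first argument names the index type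
  of the parameter space; types of equal cardinality give the same measure.\<close>

definition surface_measure :: "'m::finite itself \<Rightarrow> (real^'n) set \<Rightarrow> (real^'n) measure" where
  "surface_measure _ S =
     (SUP (U, \<phi>) \<in> (local_parametrizations S :: ((real^'m) set \<times> (real^'m \<Rightarrow> real^'n)) set).
        patch_measure U \<phi>)"

definition pderiv_at :: "'n \<Rightarrow> (real^'n \<Rightarrow> real) \<Rightarrow> real^'n \<Rightarrow> real" where
  "pderiv_at i f x = frechet_derivative f (at x) (axis i 1)"

definition grad :: "(real^'n \<Rightarrow> real) \<Rightarrow> real^'n \<Rightarrow> real^'n" where
  "grad f x = (\<chi> i. pderiv_at i f x)"

definition diverg :: "(real^'n \<Rightarrow> real^'n) \<Rightarrow> real^'n \<Rightarrow> real" where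
  "diverg F x = (\<Sum>i\<in>UNIV. pderiv_at i (\<lambda>y. F y $ i) x)"

definition laplace :: "(real^'n \<Rightarrow> real) \<Rightarrow> real^'n \<Rightarrow> real" where
  "laplace f x = diverg (grad f) x"

definition vlaplace :: "(real^'n \<Rightarrow> real^'n) \<Rightarrow> real^'n \<Rightarrow> real^'n" where
  "vlaplace F x = (\<chi> i. laplace (\<lambda>y. F y $ i) x)"

definition advect :: "(real^'n \<Rightarrow> real^'n) \<Rightarrow> (real^'n \<Rightarrow> real^'n) \<Rightarrow> real^'n \<Rightarrow> real^'n" where
  "advect u F x = (\<chi> i. u x \<bullet> grad (\<lambda>y. F y $ i) x)"

end

theory Submission
  imports Defs
begin

text \<open>
  Suppose that the velocity vanishes identically. The momentum equation then says
  \<open>\<nabla>p = - \<rho> \<nabla>\<Phi>\<close> in \<open>\<Omega>\<close>, and by continuity this holds on the closure as well. Write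
  \<open>\<tau> = n\<^sub>i \<partial>\<^sub>j - n\<^sub>j \<partial>\<^sub>i\<close>, a derivation along a tangent field. Since \<open>\<rho> = \<gamma>1 - \<gamma>2\<close> and \<open>\<Phi> = W\<close>
  on the boundary,
  \<open>(\<gamma>1 - \<gamma>2) \<tau>W = - \<tau>p\<close> and \<open>W \<tau>(\<gamma>1 - \<gamma>2) = \<tau>(\<rho>\<Phi>) - \<rho> \<tau>\<Phi> = \<tau>(\<rho>\<Phi> + p)\<close>.
  Both integrands are thus tangential derivatives of functions that are \<open>C\<^sup>1\<close> near the boundary,
  and both integrals vanish because of \<open>integral_tangential_deriv_eq_0\<close>: the integral of \<open>\<tau>f\<close>
  over the closed hypersurface \<open>\<partial>\<Omega>\<close> is zero. This is an instance of Stokes' theorem.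

  It is proved in charts. A \<open>C\<^sup>1\<close> partition of unity reduces it to functions \<open>f\<close> supported near one
  boundary point, where the boundary is a graph \<open>x\<^sub>k = g(x')\<close>. There the surface element
  \<open>sqrt (1 + \<bar>\<nabla>g\<bar>\<^sup>2)\<close> cancels the normalization of the normal vector. In terms of \<open>h(x') = f(x', g(x'))\<close>
  the integrand becomes, up to sign, a partial derivative of \<open>h\<close> if \<open>k\<close> is one of \<open>i, j\<close>, and
  \<open>\<partial>\<^sub>jg \<partial>\<^sub>ih - \<partial>\<^sub>ig \<partial>\<^sub>jh = \<partial>\<^sub>i(h \<partial>\<^sub>jg) - \<partial>\<^sub>j(h \<partial>\<^sub>ig)\<close> otherwise, by the symmetry of the second
  derivatives of \<open>g\<close>. Partial derivatives of compactly supported functions have integral zero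
  (\<open>integral_directional_derivative_compact_support\<close>).

  The surface measure is a supremum over all local parametrizations, so its restriction to a graph
  patch has to be identified. By the change of variables formula no patch measure exceeds that of
  the graph chart on subsets of the graph patch (\<open>patch_measure_le\<close>), and hence neither does their
  supremum (\<open>emeasure_SUP_dominated\<close>).
\<close>

section \<open>Differential and integral calculus\<close>

abbreviation FD :: "('a::real_normed_vector \<Rightarrow> 'b::real_normed_vector) \<Rightarrow> 'a \<Rightarrow> 'a \<Rightarrow> 'b" where
  "FD f x \<equiv> frechet_derivative f (at x)"

lemma C1_on_has_derivative:
  assumes "Ck_on (Suc 0) V f" "x \<in> V"
  shows "(f has_derivative FD f x) (at x)"
  using assms by (auto simp: frechet_derivative_works)

lemma C1_on_continuous_on:
  assumes "Ck_on (Suc 0) V f" shows "continuous_on V f"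
  using assms by (auto intro!: continuous_at_imp_continuous_on differentiable_imp_continuous_within)

lemma C1_on_continuous_on_FD:
  assumes "Ck_on (Suc 0) V f" shows "continuous_on V (\<lambda>x. FD f x v)"
  using assms by auto

lemma C1_onI:
  assumes "\<And>x. x \<in> V \<Longrightarrow> (f has_derivative D x) (at x)" "\<And>v. continuous_on V (\<lambda>x. D x v)"
  shows "Ck_on (Suc 0) V f"
proof -
  have "FD f x = D x" if "x \<in> V" for x
    using frechet_derivative_at[OF assms(1)[OF that]] by simp
  then show ?thesis
    using assms by (auto simp: differentiable_def cong: continuous_on_cong)
qed

lemma C1_on_subset:
  assumes "Ck_on (Suc 0) V f" "U \<subseteq> V" shows "Ck_on (Suc 0) U f"
  using assms by (auto intro: continuous_on_subset)

lemma C1_on_const: "Ck_on (Suc 0) V (\<lambda>x. c)"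
  by (rule C1_onI[where D = "\<lambda>_ _. 0"]) auto

lemma C1_on_add:
  assumes "Ck_on (Suc 0) V f" "Ck_on (Suc 0) V g"
  shows "Ck_on (Suc 0) V (\<lambda>x. f x + g x)"
  using assms
  by (intro C1_onI[where D = "\<lambda>x v. FD f x v + FD g x v"])
     (auto intro!: has_derivative_add C1_on_has_derivative continuous_on_add)

lemma C1_on_sum:
  assumes "\<And>i. i \<in> I \<Longrightarrow> Ck_on (Suc 0) V (f i)"
  shows "Ck_on (Suc 0) V (\<lambda>x. \<Sum>i\<in>I. f i x)"
  using assms
  by (intro C1_onI[where D = "\<lambda>x v. \<Sum>i\<in>I. FD (f i) x v"])
     (auto intro!: has_derivative_sum C1_on_has_derivative[where V = V] continuous_on_sum
       C1_on_continuous_on_FD simp del: Ck_on.simps)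

lemma C1_on_mult:
  fixes f g :: "'a::real_normed_vector \<Rightarrow> real"
  assumes f: "Ck_on (Suc 0) V f" and g: "Ck_on (Suc 0) V g"
  shows "Ck_on (Suc 0) V (\<lambda>x. f x * g x)"
  using assms
  by (intro C1_onI[where D = "\<lambda>x v. f x * FD g x v + FD f x v * g x"])
     (auto intro!: has_derivative_mult C1_on_has_derivative continuous_intros
       C1_on_continuous_on[OF f] C1_on_continuous_on[OF g])

lemma C1_on_inverse:
  fixes f :: "'a::real_normed_vector \<Rightarrow> real"
  assumes f: "Ck_on (Suc 0) V f" and nz: "\<And>x. x \<in> V \<Longrightarrow> f x \<noteq> 0"
  shows "Ck_on (Suc 0) V (\<lambda>x. inverse (f x))"
  using assms
  by (intro C1_onI[where D = "\<lambda>x v. - (inverse (f x) * FD f x v * inverse (f x))"])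
     (auto intro!: Deriv.has_derivative_inverse C1_on_has_derivative continuous_intros
       C1_on_continuous_on[OF f])

lemma has_real_derivative_pospart_squared:
  "((\<lambda>t::real. (max 0 t)\<^sup>2) has_real_derivative 2 * max 0 t) (at t)"
proof -
  consider "t > 0" | "t < 0" | "t = 0" by linarith
  then show ?thesis
  proof cases
    case 1
    have "((\<lambda>t::real. t\<^sup>2) has_real_derivative 2 * t) (at t)"
      by (auto intro!: derivative_eq_intros)
    moreover have "eventually (\<lambda>s. s \<in> {0<..}) (nhds t)"
      using 1 by (intro eventually_nhds_in_open) auto
    ultimately show ?thesis
      using 1 by (subst DERIV_cong_ev[OF refl _ refl]) (auto elim!: eventually_mono)
  next
    case 2
    have "((\<lambda>t::real. 0) has_real_derivative 2 * max 0 t) (at t)"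
      using 2 by simp
    then show ?thesis
      by (rule has_field_derivative_transform_within_open[where S = "{..<0}"]) (use 2 in auto)
  next
    case 3
    have "((\<lambda>h::real. (max 0 h)\<^sup>2 / h) \<longlongrightarrow> 0) (at 0)"
    proof (rule Lim_null_comparison)
      show "\<forall>\<^sub>F h in at 0. norm ((max 0 h)\<^sup>2 / h) \<le> \<bar>h\<bar>"
        by (rule always_eventually) (auto simp: max_def power2_eq_square)
      show "((\<lambda>h::real. \<bar>h\<bar>) \<longlongrightarrow> 0) (at 0)"
        by (auto intro!: tendsto_eq_intros)
    qed
    then show ?thesis
      using 3 by (simp add: DERIV_def)
  qed
qed

text \<open>The bump functions enter only through their first derivatives, so \<open>C\<^sup>1\<close> regularity, which a
  squared positive part has, is enough for the partition of unity built from them.\<close>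

definition bump :: "'a::real_inner \<Rightarrow> real \<Rightarrow> 'a \<Rightarrow> real" where
  "bump p r x = (max 0 (r\<^sup>2 - (x - p) \<bullet> (x - p)))\<^sup>2"

lemma C1_on_bump: "Ck_on (Suc 0) V (bump p r)"
proof (rule C1_onI)
  fix x :: 'a
  have "((\<lambda>x. r\<^sup>2 - (x - p) \<bullet> (x - p)) has_derivative (\<lambda>v. - 2 * ((x - p) \<bullet> v))) (at x)"
    by (auto intro!: derivative_eq_intros simp: inner_commute algebra_simps)
  from DERIV_compose_FDERIV[OF has_real_derivative_pospart_squared this]
  show "(bump p r has_derivative
     (\<lambda>v. (- 2 * ((x - p) \<bullet> v)) * (2 * max 0 (r\<^sup>2 - (x - p) \<bullet> (x - p))))) (at x)"
    by (simp add: bump_def[abs_def])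
qed (intro continuous_intros)

lemma bump_nonneg: "bump p r x \<ge> 0"
  by (simp add: bump_def)

lemma bump_pos_iff:
  assumes "r > 0"
  shows "bump p r x > 0 \<longleftrightarrow> x \<in> ball p r"
proof -
  have "(x - p) \<bullet> (x - p) = (dist p x)\<^sup>2"
    by (metis dist_norm norm_minus_commute power2_norm_eq_inner)
  then show ?thesis
    using assms power2_less_imp_less[of "dist p x" r] power_strict_mono[of "dist p x" r 2]
    by (auto simp: bump_def max_def)
qed

text \<open>By translation invariance of Lebesgue measure every difference quotient of \<open>h\<close> in direction \<open>v\<close>
  has integral zero. By the mean value theorem the quotients are bounded by \<open>B\<close>, and those with
  step at most 1 vanish off a fixed ball, so dominated convergence passes to the derivative.\<close>

lemma integral_directional_derivative_eq_0:
  fixes h :: "'a::euclidean_space \<Rightarrow> real"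
  assumes der: "\<And>x. (h has_derivative h' x) (at x)"
    and bnd: "\<And>x. \<bar>h' x v\<bar> \<le> B"
    and supp: "\<And>x. norm x > R \<Longrightarrow> h x = 0"
  shows "integrable lborel (\<lambda>x. h' x v)" and "(LINT x|lborel. h' x v) = 0"
proof -
  define e where "e n = inverse (real (Suc n))" for n
  have e: "0 < e n" "e n \<le> 1" for n
    by (auto simp: e_def field_simps)
  define q where "q n x = (h (x + e n *\<^sub>R v) - h x) / e n" for n x
  have conth: "continuous_on A h" for A
    using der by (auto intro!: continuous_at_imp_continuous_on has_derivative_continuous)
  have [measurable]: "h \<in> borel_measurable borel"
    by (rule borel_measurable_continuous_onI[OF conth])
  have inth: "integrable lborel h"
  proof -
    have "integrable lborel (\<lambda>x. indicator (cball 0 R) x *\<^sub>R h x)"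
      by (rule borel_integrable_compact) (auto intro: conth)
    moreover have "(\<lambda>x. indicator (cball 0 R) x *\<^sub>R h x) = h"
      using supp by (auto simp: indicator_def fun_eq_iff not_le)
    ultimately show ?thesis by simp
  qed
  have shift: "integrable lborel (\<lambda>x. h (x + c))" "(LINT x|lborel. h (x + c)) = (LINT x|lborel. h x)" for c
  proof -
    have "integrable (distr lborel borel ((+) c)) h"
      using inth by (simp add: lborel_distr_plus)
    then show "integrable lborel (\<lambda>x. h (x + c))"
      by (subst (asm) integrable_distr_eq) (auto simp: add.commute)
    have "(LINT x|distr lborel borel ((+) c). h x) = (LINT x|lborel. h (c + x))"
      by (rule integral_distr) auto
    then show "(LINT x|lborel. h (x + c)) = (LINT x|lborel. h x)"
      by (simp add: lborel_distr_plus add.commute)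
  qed
  have lim: "(\<lambda>n. q n x) \<longlonglongrightarrow> h' x v" for x
  proof -
    have "((\<lambda>t. x + t *\<^sub>R v) has_derivative (\<lambda>t. t *\<^sub>R v)) (at 0)"
      by (auto intro!: derivative_eq_intros)
    moreover have "(h has_derivative h' x) (at (x + 0 *\<^sub>R v))"
      using der by simp
    ultimately have "((\<lambda>t. h (x + t *\<^sub>R v)) has_derivative (\<lambda>t. h' x (t *\<^sub>R v))) (at 0)"
      by (rule has_derivative_compose)
    moreover have "h' x (t *\<^sub>R v) = h' x v * t" for t
      using has_derivative_bounded_linear[OF der[of x]] by (simp add: linear_simps)
    ultimately have "((\<lambda>t. h (x + t *\<^sub>R v)) has_real_derivative h' x v) (at 0)"
      by (simp add: has_field_derivative_def)
    then have "((\<lambda>t. (h (x + t *\<^sub>R v) - h x) / t) \<longlongrightarrow> h' x v) (at 0)"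
      by (simp add: DERIV_def)
    moreover have "filterlim e (at 0) sequentially"
      unfolding e_def filterlim_at using LIMSEQ_inverse_real_of_nat
      by (auto simp del: of_nat_Suc)
    ultimately show ?thesis
      unfolding q_def by (rule filterlim_compose)
  qed
  have qB: "\<bar>q n x\<bar> \<le> B" for n x
  proof -
    have "((\<lambda>t. h (x + t *\<^sub>R v)) has_real_derivative h' (x + t *\<^sub>R v) v) (at t)" for t
    proof -
      have "((\<lambda>t. x + t *\<^sub>R v) has_derivative (\<lambda>t. t *\<^sub>R v)) (at t)"
        by (auto intro!: derivative_eq_intros)
      from has_derivative_compose[OF this der]
      have "((\<lambda>t. h (x + t *\<^sub>R v)) has_derivative (\<lambda>s. h' (x + t *\<^sub>R v) (s *\<^sub>R v))) (at t)" .
      moreover have "h' (x + t *\<^sub>R v) (s *\<^sub>R v) = h' (x + t *\<^sub>R v) v * s" for s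
        using has_derivative_bounded_linear[OF der[of "x + t *\<^sub>R v"]] by (simp add: linear_simps)
      ultimately show ?thesis
        by (simp add: has_field_derivative_def)
    qed
    from MVT2[OF e(1)[of n] this] obtain z where
      "h (x + e n *\<^sub>R v) - h (x + 0 *\<^sub>R v) = (e n - 0) * h' (x + z *\<^sub>R v) v"
      by blast
    then have "q n x = h' (x + z *\<^sub>R v) v"
      using e(1)[of n] by (simp add: q_def)
    then show ?thesis using bnd by simp
  qed
  have dom: "norm (q n x) \<le> B * indicator (cball 0 (R + norm v)) x" for n x
  proof (cases "norm x \<le> R + norm v")
    case True
    then show ?thesis using qB by simp
  next
    case False
    have "norm x \<le> norm (x + e n *\<^sub>R v) + norm (e n *\<^sub>R v)"
      by (metis add_diff_cancel norm_triangle_ineq4)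
    moreover have "norm (e n *\<^sub>R v) \<le> norm v"
      using e[of n] by (simp add: mult_left_le_one_le)
    ultimately have "norm (x + e n *\<^sub>R v) > R" "norm x > R"
      using False norm_ge_zero[of v] by linarith+
    then show ?thesis
      using False by (simp add: q_def supp)
  qed
  have intq: "(LINT x|lborel. q n x) = 0" for n
    using inth shift[of "e n *\<^sub>R v"] by (simp add: q_def)
  have mlim: "(\<lambda>x. h' x v) \<in> borel_measurable lborel"
    by (rule borel_measurable_LIMSEQ_metric[OF _ lim]) (simp add: q_def[abs_def])
  have mq: "q n \<in> borel_measurable lborel" for n
    by (simp add: q_def[abs_def])
  have w: "integrable lborel (\<lambda>x. B * indicator (cball 0 (R + norm v)) x)"
    by (auto intro!: integrable_mult_right integrable_real_indicator emeasure_lborel_cball_finite)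
  show "integrable lborel (\<lambda>x. h' x v)"
    by (rule integrable_dominated_convergence[where s = q, OF mlim mq w]) (use lim dom in auto)
  have "(\<lambda>n. LINT x|lborel. q n x) \<longlonglongrightarrow> (LINT x|lborel. h' x v)"
    by (rule integral_dominated_convergence[where s = q, OF mlim mq w]) (use lim dom in auto)
  then show "(LINT x|lborel. h' x v) = 0"
    unfolding intq using tendsto_const LIMSEQ_unique by metis
qed

lemma integral_directional_derivative_compact_support:
  fixes h :: "'a::euclidean_space \<Rightarrow> real"
  assumes der: "\<And>x. (h has_derivative h' x) (at x)" and K: "compact K"
    and h0: "\<And>x. x \<notin> K \<Longrightarrow> h x = 0" and cont: "continuous_on K (\<lambda>x. h' x v)"
  shows "integrable lborel (\<lambda>x. h' x v)" and "(LINT x|lborel. h' x v) = 0"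
proof -
  have "h' x = (\<lambda>v. 0)" if "x \<notin> K" for x
  proof -
    have "((\<lambda>x. 0 :: real) has_derivative (\<lambda>v. 0)) (at x)"
      by simp
    then have "(h has_derivative (\<lambda>v. 0)) (at x)"
      by (rule has_derivative_transform_within_open[of _ _ _ _ "- K"])
        (use that h0 compact_imp_closed[OF K] in auto)
    then show ?thesis
      by (rule has_derivative_unique[OF der])
  qed
  moreover have "bounded ((\<lambda>x. h' x v) ` K)"
    using compact_continuous_image[OF cont K] by (rule compact_imp_bounded)
  then obtain B where B: "B > 0" "\<And>x. x \<in> K \<Longrightarrow> \<bar>h' x v\<bar> \<le> B"
    by (auto simp: bounded_pos)
  ultimately have bnd: "\<bar>h' x v\<bar> \<le> B" for x
    by (cases "x \<in> K") auto
  obtain R where "\<And>x. x \<in> K \<Longrightarrow> norm x \<le> R"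
    using compact_imp_bounded[OF K] by (auto simp: bounded_iff)
  then have supp: "h x = 0" if "norm x > R" for x
    using that h0 by force
  show "integrable lborel (\<lambda>x. h' x v)"
    by (rule integral_directional_derivative_eq_0(1)[OF der bnd, where R = R]) (rule supp)
  show "(LINT x|lborel. h' x v) = 0"
    by (rule integral_directional_derivative_eq_0(2)[OF der bnd, where R = R]) (rule supp)
qed

lemma directional_mean_value:
  fixes g :: "'a::real_normed_vector \<Rightarrow> real"
  assumes "t > 0" and "\<And>x. g differentiable (at x)"
  obtains s where "0 < s" "s < t" "g (x + t *\<^sub>R v) - g x = t * FD g (x + s *\<^sub>R v) v"
proof -
  have "((\<lambda>t. g (x + t *\<^sub>R v)) has_real_derivative FD g (x + t *\<^sub>R v) v) (at t)" for t
  proof -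
    have "((\<lambda>t. x + t *\<^sub>R v) has_derivative (\<lambda>t. t *\<^sub>R v)) (at t)"
      by (auto intro!: derivative_eq_intros)
    from has_derivative_compose[OF this assms(2)[unfolded frechet_derivative_works]]
    have "((\<lambda>t. g (x + t *\<^sub>R v)) has_derivative (\<lambda>s. FD g (x + t *\<^sub>R v) (s *\<^sub>R v))) (at t)" .
    moreover have "FD g (x + t *\<^sub>R v) (s *\<^sub>R v) = FD g (x + t *\<^sub>R v) v * s" for s
      using linear_frechet_derivative[OF assms(2)] by (simp add: linear_scale)
    ultimately show ?thesis
      by (simp add: has_field_derivative_def)
  qed
  from MVT2[OF \<open>t > 0\<close> this] that show thesis by auto
qed

text \<open>The second difference of \<open>g\<close> along \<open>v\<close> and \<open>w\<close> is symmetric in the two vectors. Two applications of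
  the mean value theorem express it through either mixed derivative at a nearby point, and
  continuity of both mixed derivatives gives the equality in the limit.\<close>

lemma symmetric_second_derivative:
  fixes g :: "'a::real_normed_vector \<Rightarrow> real"
  assumes g: "Ck_on (Suc (Suc 0)) UNIV g"
  shows "FD (\<lambda>x. FD g x v) x w = FD (\<lambda>x. FD g x w) x v"
proof -
  have mixed: "\<exists>y. dist y x \<le> t * (norm v + norm w) \<and>
      g (x + t *\<^sub>R v + t *\<^sub>R w) - g (x + t *\<^sub>R v) - g (x + t *\<^sub>R w) + g x
        = t * t * FD (\<lambda>x. FD g x v) y w" if t: "t > 0" for t v w
  proof -
    let ?G = "\<lambda>y. g (y + t *\<^sub>R w) - g y"
    have dg: "g differentiable (at y)" "(\<lambda>x. FD g x v) differentiable (at y)" for y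
      using g by auto
    have dG: "(?G has_derivative (\<lambda>z. FD g (y + t *\<^sub>R w) z - FD g y z)) (at y)" for y
    proof -
      have "((\<lambda>y. g (y + t *\<^sub>R w)) has_derivative FD g (y + t *\<^sub>R w)) (at y)"
        using has_derivative_compose[of "\<lambda>y. y + t *\<^sub>R w" "\<lambda>z. z" y UNIV g "FD g (y + t *\<^sub>R w)",
            OF _ dg(1)[unfolded frechet_derivative_works]]
        by (simp add: has_derivative_add_const)
      then show ?thesis
        using dg(1)[unfolded frechet_derivative_works] by (intro has_derivative_diff) auto
    qed
    then have FG: "FD ?G y = (\<lambda>z. FD g (y + t *\<^sub>R w) z - FD g y z)" for y
      using frechet_derivative_at[OF dG] by simp
    obtain s where s: "0 < s" "s < t"
        "?G (x + t *\<^sub>R v) - ?G x = t * FD ?G (x + s *\<^sub>R v) v"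
      using directional_mean_value[OF t, of ?G] dG unfolding differentiable_def by blast
    obtain s' where s': "0 < s'" "s' < t"
        "FD g (x + s *\<^sub>R v + t *\<^sub>R w) v - FD g (x + s *\<^sub>R v) v
          = t * FD (\<lambda>x. FD g x v) (x + s *\<^sub>R v + s' *\<^sub>R w) w"
      using directional_mean_value[OF t, of "\<lambda>x. FD g x v"] dg by blast
    have "norm (s *\<^sub>R v + s' *\<^sub>R w) \<le> s * norm v + s' * norm w"
      using s s' by (intro order_trans[OF norm_triangle_ineq]) simp
    also have "\<dots> \<le> t * (norm v + norm w)"
      using s s' by (simp add: distrib_left add_mono mult_right_mono)
    finally show ?thesis
      using s s' by (intro exI[of _ "x + s *\<^sub>R v + s' *\<^sub>R w"])
        (auto simp: dist_norm FG algebra_simps)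
  qed
  define e where "e n = inverse (real (Suc n))" for n
  have e: "e n > 0" for n by (simp add: e_def)
  have e0: "(\<lambda>n. e n * (norm v + norm w)) \<longlonglongrightarrow> 0"
    using tendsto_mult_left_zero[OF LIMSEQ_inverse_real_of_nat] by (simp add: e_def)
  have "\<forall>n. \<exists>y. dist y x \<le> e n * (norm v + norm w) \<and>
      g (x + e n *\<^sub>R v + e n *\<^sub>R w) - g (x + e n *\<^sub>R v) - g (x + e n *\<^sub>R w) + g x
        = e n * e n * FD (\<lambda>x. FD g x v) y w"
    using mixed[OF e] by blast
  then obtain y where y: "\<And>n. dist (y n) x \<le> e n * (norm v + norm w)"
     "\<And>n. g (x + e n *\<^sub>R v + e n *\<^sub>R w) - g (x + e n *\<^sub>R v) - g (x + e n *\<^sub>R w) + g x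
        = e n * e n * FD (\<lambda>x. FD g x v) (y n) w"
    unfolding choice_iff by blast
  have "\<forall>n. \<exists>z. dist z x \<le> e n * (norm w + norm v) \<and>
      g (x + e n *\<^sub>R w + e n *\<^sub>R v) - g (x + e n *\<^sub>R w) - g (x + e n *\<^sub>R v) + g x
        = e n * e n * FD (\<lambda>x. FD g x w) z v"
    using mixed[OF e] by blast
  then obtain z where z: "\<And>n. dist (z n) x \<le> e n * (norm w + norm v)"
     "\<And>n. g (x + e n *\<^sub>R w + e n *\<^sub>R v) - g (x + e n *\<^sub>R w) - g (x + e n *\<^sub>R v) + g x
        = e n * e n * FD (\<lambda>x. FD g x w) (z n) v"
    unfolding choice_iff by blast
  have eq: "FD (\<lambda>x. FD g x v) (y n) w = FD (\<lambda>x. FD g x w) (z n) v" for n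
  proof -
    have swap: "x + e n *\<^sub>R w + e n *\<^sub>R v = x + e n *\<^sub>R v + e n *\<^sub>R w"
      by (simp add: add_ac)
    have "e n * e n * FD (\<lambda>x. FD g x v) (y n) w
        = g (x + e n *\<^sub>R v + e n *\<^sub>R w) - g (x + e n *\<^sub>R v) - g (x + e n *\<^sub>R w) + g x"
      by (rule y(2)[symmetric])
    also have "\<dots> = g (x + e n *\<^sub>R w + e n *\<^sub>R v) - g (x + e n *\<^sub>R w) - g (x + e n *\<^sub>R v) + g x"
      unfolding swap by simp
    also have "\<dots> = e n * e n * FD (\<lambda>x. FD g x w) (z n) v"
      by (rule z(2))
    finally have "e n * e n * FD (\<lambda>x. FD g x v) (y n) w = e n * e n * FD (\<lambda>x. FD g x w) (z n) v" .
    then show ?thesis using e[of n] by simp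
  qed
  have lim: "(\<lambda>n. F (y n)) \<longlonglongrightarrow> F x"
    if "\<And>n. dist (y n) x \<le> e n * (norm v + norm w)" "continuous_on UNIV F" for y and F :: "'a \<Rightarrow> real"
  proof -
    have "(\<lambda>n. dist (y n) x) \<longlonglongrightarrow> 0"
      by (rule Lim_null_comparison[OF _ e0]) (simp add: that)
    then have "y \<longlonglongrightarrow> x" by (rule tendsto_dist_iff[THEN iffD2])
    moreover have "isCont F x"
      using that(2) by (simp add: continuous_on_eq_continuous_at)
    ultimately show ?thesis
      by (rule isCont_tendsto_compose[rotated])
  qed
  have 1: "(\<lambda>n. FD (\<lambda>x. FD g x v) (y n) w) \<longlonglongrightarrow> FD (\<lambda>x. FD g x v) x w"
    by (rule lim) (use y(1) g in auto)
  have 2: "(\<lambda>n. FD (\<lambda>x. FD g x w) (z n) v) \<longlonglongrightarrow> FD (\<lambda>x. FD g x w) x v"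
    by (rule lim) (use z(1) g in \<open>auto simp: add.commute\<close>)
  from 1 2 show ?thesis unfolding eq using LIMSEQ_unique by blast
qed

section \<open>Graphs over coordinate hyperplanes\<close>

lemma matrix_add_rdistrib: "((A + B) ** C) = (A ** C) + (B ** C)"
  for A B :: "'a::semiring_1^'n^'m"
  by (vector matrix_matrix_mult_def sum.distrib[symmetric] field_simps)

text \<open>An orthogonal change of basis turns \<open>a\<close> into a multiple of a basis vector and the matrix into
  a diagonal one. The lemma evaluates the Gram determinant of a graph.\<close>

lemma det_mat_1_plus_outer_product:
  fixes a :: "real^'m"
  shows "det (\<chi> i j. (if i = j then 1 else 0) + a $ i * a $ j) = 1 + a \<bullet> a"
proof (cases "a = 0")
  case True
  then have "(\<chi> i j. (if i = j then 1 else 0) + a $ i * a $ j) = (mat 1 :: real^'m^'m)"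
    by (simp add: mat_def vec_eq_iff)
  then show ?thesis using True by simp
next
  case False
  let ?A = "(\<chi> i j. a $ i * a $ j) :: real^'m^'m"
  let ?k = "undefined :: 'm"
  have M: "(\<chi> i j. (if i = j then 1 else 0) + a $ i * a $ j) = mat 1 + ?A" (is "?M = _")
    by (simp add: mat_def vec_eq_iff)
  have "norm (a /\<^sub>R norm a) = 1" using False by simp
  then obtain Q :: "real^'m^'m" where Q: "orthogonal_matrix Q" "Q *v axis ?k 1 = a /\<^sub>R norm a"
    using orthogonal_matrix_exists_basis by metis
  have QQ: "transpose Q ** Q = mat 1"
    using Q(1) by (simp add: orthogonal_matrix)
  have "transpose Q *v a = norm a *\<^sub>R (transpose Q *v (Q *v axis ?k 1))"
    using False by (simp add: Q(2) matrix_vector_mult_scaleR)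
  then have b: "transpose Q *v a = norm a *\<^sub>R axis ?k 1"
    by (simp add: matrix_vector_mul_assoc QQ)
  have "transpose Q ** ?A ** Q = (\<chi> i j. (transpose Q *v a) $ i * (transpose Q *v a) $ j)"
    by (simp add: vec_eq_iff matrix_matrix_mult_def matrix_vector_mult_def transpose_def
        sum_distrib_left sum_distrib_right mult_ac)
  then have "transpose Q ** ?M ** Q
      = mat 1 + (\<chi> i j. (transpose Q *v a) $ i * (transpose Q *v a) $ j)"
    by (simp add: M matrix_add_ldistrib matrix_add_rdistrib QQ)
  also have "\<dots> = (\<chi> i j. if i = j then (if i = ?k then 1 + a \<bullet> a else 1) else 0)"
    unfolding b by (auto simp: vec_eq_iff mat_def axis_def power2_norm_eq_inner[symmetric] power2_eq_square)
  finally have "det (transpose Q ** ?M ** Q) = (\<Prod>i\<in>UNIV. if i = ?k then 1 + a \<bullet> a else 1)"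
    by (simp add: det_diagonal)
  then have "det Q * det Q * det ?M = 1 + a \<bullet> a"
    by (simp add: det_mul prod.delta mult_ac)
  moreover have "det Q * det Q = 1"
    using det_orthogonal_matrix[OF Q(1)] by auto
  ultimately show ?thesis by simp
qed

text \<open>This shape is closed under directional derivatives, the linear part \<open>B\<close> becoming a constant,
  and so admits an induction on \<open>n\<close>. With \<open>A = B\<close> it is the parametrization of a graph.\<close>

lemma Ck_on_affine_plus_compose_linear:
  fixes A :: "'a::real_normed_vector \<Rightarrow> 'b::real_normed_vector" and B :: "'a \<Rightarrow> 'c::real_normed_vector"
  assumes A: "bounded_linear A" and B: "bounded_linear B"
    and "Ck_on n UNIV (g :: 'b \<Rightarrow> real)"
  shows "Ck_on n UNIV (\<lambda>w. B w + b + g (A w) *\<^sub>R c)"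
  using assms(2,3)
proof (induction n arbitrary: g B b)
  case 0
  have "continuous_on UNIV (\<lambda>w. g (A w))"
    using 0 by (auto intro: continuous_on_compose2 bounded_linear.continuous_on[OF A continuous_on_id])
  then show ?case
    using bounded_linear.continuous_on[OF 0(1) continuous_on_id]
    by (simp add: continuous_on_add continuous_on_scaleR)
next
  case (Suc n)
  have der: "((\<lambda>w. B w + b + g (A w) *\<^sub>R c) has_derivative (\<lambda>v. B v + FD g (A w) (A v) *\<^sub>R c)) (at w)" for w
  proof -
    have "(g has_derivative FD g (A w)) (at (A w))"
      using Suc.prems by (simp add: frechet_derivative_works)
    from has_derivative_compose[OF bounded_linear_imp_has_derivative[OF A] this]
    show ?thesis
      by (auto intro!: derivative_eq_intros bounded_linear_imp_has_derivative Suc.prems)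
  qed
  have "Ck_on n UNIV (\<lambda>w. 0 + B v + FD g (A w) (A v) *\<^sub>R c)" for v
    using Suc.prems by (intro Suc.IH) auto
  then show ?case
    using der frechet_derivative_at[OF der, symmetric] by (auto simp: differentiable_def)
qed

lemma Ck_on_subset: "Ck_on n V f \<Longrightarrow> U \<subseteq> V \<Longrightarrow> Ck_on n U f"
  by (induction n arbitrary: f) (auto intro: continuous_on_subset)

text \<open>The graph \<open>x\<^sub>k = g(x')\<close>. The bijection \<open>e\<close> enumerates the coordinates other than \<open>k\<close> and so identifies
  the hyperplane \<open>x\<^sub>k = 0\<close> with the parameter space.\<close>

locale graph_chart =
  fixes k :: "'n::finite" and e :: "'m::finite \<Rightarrow> 'n" and g :: "real^'n \<Rightarrow> real"
  assumes bij: "bij_betw e UNIV (- {k})" and smooth: "smooth_on UNIV g"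
begin

definition base :: "real^'n \<Rightarrow> real^'n" where
  "base x = (\<chi> i. if i = k then 0 else x $ i)"

definition emb :: "real^'m \<Rightarrow> real^'n" where
  "emb w = (\<chi> i. if i = k then 0 else w $ inv e i)"

definition proj :: "real^'n \<Rightarrow> real^'m" where
  "proj x = (\<chi> l. x $ e l)"

definition chart :: "real^'m \<Rightarrow> real^'n" where
  "chart w = emb w + g (emb w) *\<^sub>R axis k 1"

text \<open>The gradient of \<open>g\<close> in the coordinates of the parameter space.\<close>

definition slope :: "real^'m \<Rightarrow> real^'m" where
  "slope w = (\<chi> l. FD g (emb w) (axis (e l) 1))"

lemma e_neq [simp]: "e l \<noteq> k" "k \<noteq> e l"
  using bij by (auto simp: bij_betw_def)

lemma inj_e: "inj e"
  using bij by (auto simp: bij_betw_def)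

lemma e_eq_iff [simp]: "e l = e l' \<longleftrightarrow> l = l'"
  using inj_e by (auto dest: injD)

lemma inv_e [simp]: "inv e (e l) = l" "i \<noteq> k \<Longrightarrow> e (inv e i) = i"
proof -
  show "inv e (e l) = l" using inj_e by simp
  show "e (inv e i) = i" if "i \<noteq> k"
    using that bij by (intro f_inv_into_f) (auto simp: bij_betw_def)
qed

lemma linear_emb: "linear emb"
  by (rule linearI) (auto simp: emb_def vec_eq_iff)

lemma linear_proj: "linear proj"
  by (rule linearI) (auto simp: proj_def vec_eq_iff)

lemma linear_base: "linear base"
  by (rule linearI) (auto simp: base_def vec_eq_iff)

lemmas bounded_linear_emb = linear_emb[unfolded linear_conv_bounded_linear]
lemmas bounded_linear_proj = linear_proj[unfolded linear_conv_bounded_linear]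
lemmas bounded_linear_base = linear_base[unfolded linear_conv_bounded_linear]

lemma proj_emb [simp]: "proj (emb w) = w"
  by (simp add: proj_def emb_def vec_eq_iff)

lemma emb_proj [simp]: "emb (proj x) = base x"
  by (auto simp: proj_def emb_def base_def vec_eq_iff)

lemma emb_axis: "emb (axis l 1) = axis (e l) 1"
  by (auto simp: emb_def axis_def vec_eq_iff)

lemma proj_chart [simp]: "proj (chart w) = w"
  by (simp add: proj_def chart_def emb_def vec_eq_iff axis_def)

lemma base_chart [simp]: "base (chart w) = emb w"
  by (simp add: base_def chart_def emb_def vec_eq_iff axis_def)

lemma chart_nth_k [simp]: "chart w $ k = g (emb w)"
  by (simp add: chart_def emb_def)

lemma chart_proj: "x $ k = g (base x) \<Longrightarrow> chart (proj x) = x"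
  by (auto simp: chart_def base_def axis_def vec_eq_iff)

lemma Ck_on_chart: "Ck_on n U chart"
  using Ck_on_subset[OF Ck_on_affine_plus_compose_linear[OF bounded_linear_emb bounded_linear_emb,
      where g = g and b = 0 and c = "axis k 1" and n = n]] smooth
  by (auto simp: smooth_on_def chart_def[abs_def])

lemma smooth_on_chart: "smooth_on U chart"
  using Ck_on_chart by (simp add: smooth_on_def)

lemma C2_g: "Ck_on (Suc (Suc 0)) UNIV g"
  using smooth by (simp add: smooth_on_def del: Ck_on.simps)

lemma C1_g: "Ck_on (Suc 0) UNIV g"
  using smooth by (simp add: smooth_on_def del: Ck_on.simps)

lemma has_derivative_g: "(g has_derivative FD g x) (at x)"
  using C1_on_has_derivative[OF C1_g] by simp

lemma linear_FD_g: "linear (FD g x)"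
  using has_derivative_g has_derivative_linear by blast

lemma has_derivative_chart:
  "(chart has_derivative (\<lambda>v. emb v + FD g (emb w) (emb v) *\<^sub>R axis k 1)) (at w)"
proof -
  have emb: "(emb has_derivative emb) (at w)"
    by (rule bounded_linear_imp_has_derivative[OF bounded_linear_emb])
  have "((\<lambda>w. g (emb w)) has_derivative (\<lambda>v. FD g (emb w) (emb v))) (at w)"
    by (rule has_derivative_compose[OF emb has_derivative_g])
  then have "((\<lambda>w. g (emb w) *\<^sub>R axis k 1 :: real^'n)
      has_derivative (\<lambda>v. FD g (emb w) (emb v) *\<^sub>R axis k 1)) (at w)"
    by (rule has_derivative_scaleR_left)
  from has_derivative_add[OF emb this] show ?thesis
    unfolding chart_def[abs_def] .
qed

lemma FD_chart: "FD chart w v = emb v + FD g (emb w) (emb v) *\<^sub>R axis k 1"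
  by (simp add: frechet_derivative_at[OF has_derivative_chart, symmetric])

lemma continuous_on_chart: "continuous_on A chart"
  using Ck_on_chart[of 0] by simp

lemma proj_FD_chart: "proj (FD chart w v) = v"
  by (simp add: FD_chart proj_def emb_def vec_eq_iff axis_def)

lemma inj_FD_chart: "inj (FD chart w)"
  by (metis injI proj_FD_chart)

lemma axis_decompose: "x = base x + x $ k *\<^sub>R axis k 1"
  by (auto simp: base_def vec_eq_iff axis_def)

lemma surface_element_chart: "surface_element chart w = sqrt (1 + slope w \<bullet> slope w)"
proof -
  have J: "jacobian chart (at w) $ i $ l = axis (e l) 1 $ i + slope w $ l * axis k 1 $ i" for i l
    by (simp add: jacobian_def matrix_def FD_chart emb_axis slope_def)
  have "(transpose (jacobian chart (at w)) ** jacobian chart (at w)) $ l $ l'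
     = (axis (e l) 1 + slope w $ l *\<^sub>R axis k 1) \<bullet> (axis (e l') 1 + slope w $ l' *\<^sub>R (axis k 1 :: real^'n))" for l l'
    by (simp add: matrix_matrix_mult_def transpose_def J inner_vec_def)
  also have "\<dots> l l' = (if l = l' then 1 else 0) + slope w $ l * slope w $ l'" for l l'
    by (auto simp: inner_add_left inner_add_right inner_axis_axis)
  finally have "transpose (jacobian chart (at w)) ** jacobian chart (at w)
     = (\<chi> l l'. (if l = l' then 1 else 0) + slope w $ l * slope w $ l')"
    by (simp add: vec_eq_iff)
  then show ?thesis
    by (simp add: surface_element_def det_mat_1_plus_outer_product)
qed

lemma continuous_on_slope: "continuous_on A slope"
  unfolding slope_def[abs_def]
  by (intro continuous_on_vec_lambda continuous_on_compose2[OF C1_on_continuous_on_FD[OF C1_g]])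
     (auto intro: bounded_linear.continuous_on[OF bounded_linear_emb] continuous_on_id)

end

section \<open>Patch measures and their supremum\<close>

lemma continuous_on_det:
  fixes A :: "'a::topological_space \<Rightarrow> real^'n^'n"
  assumes "\<And>i j. continuous_on S (\<lambda>x. A x $ i $ j)"
  shows "continuous_on S (\<lambda>x. det (A x))"
  unfolding det_def by (intro continuous_intros assms)

lemma continuous_on_surface_element:
  assumes "Ck_on (Suc 0) U \<phi>"
  shows "continuous_on U (surface_element \<phi>)"
proof -
  have "continuous_on U (\<lambda>u. jacobian \<phi> (at u) $ i $ j)" for i j
    unfolding jacobian_def matrix_def
    by (simp add: C1_on_continuous_on_FD[OF assms] continuous_on_component)
  then show ?thesis
    unfolding surface_element_def[abs_def] transpose_def
    by (intro continuous_on_real_sqrt continuous_on_det)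
      (simp add: matrix_matrix_mult_def continuous_on_sum continuous_on_mult)
qed

lemma local_parametrizationsD:
  assumes "(U, \<phi>) \<in> local_parametrizations S"
  shows "open U" "Ck_on (Suc 0) U \<phi>" "continuous_on U \<phi>" "inj_on \<phi> U" "\<phi> ` U \<subseteq> S"
    "\<And>u. u \<in> U \<Longrightarrow> (\<phi> has_derivative FD \<phi> u) (at u)"
proof -
  show U: "open U" and C1: "Ck_on (Suc 0) U \<phi>"
    using assms by (auto simp: local_parametrizations_def smooth_on_def simp del: Ck_on.simps)
  have "openin (top_of_set S) (\<phi> ` U)"
    using assms by (simp add: local_parametrizations_def)
  then show "\<phi> ` U \<subseteq> S" by (rule openin_imp_subset)
  show "continuous_on U \<phi>" by (rule C1_on_continuous_on[OF C1])
  show "inj_on \<phi> U"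
    using assms by (auto simp: local_parametrizations_def homeomorphism_def intro: inj_on_inverseI)
  show "\<And>u. u \<in> U \<Longrightarrow> (\<phi> has_derivative FD \<phi> u) (at u)"
    using C1_on_has_derivative[OF C1] by blast
qed

lemma sets_patch_measure [simp]: "sets (patch_measure U \<phi>) = sets borel"
  by (simp add: patch_measure_def)

lemma measurable_surface_element:
  assumes "(U, \<phi>) \<in> local_parametrizations S"
  shows "(\<lambda>u. ennreal (surface_element \<phi> u) * indicator U u) \<in> borel_measurable borel"
proof -
  note U = local_parametrizationsD[OF assms]
  have "(\<lambda>u. indicator U u *\<^sub>R surface_element \<phi> u) \<in> borel_measurable borel"
    using U(1) continuous_on_surface_element[OF U(2)]
    by (intro borel_measurable_continuous_on_indicator) auto
  then have "(\<lambda>u. ennreal (indicator U u *\<^sub>R surface_element \<phi> u)) \<in> borel_measurable borel"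
    by measurable
  also have "(\<lambda>u. ennreal (indicator U u *\<^sub>R surface_element \<phi> u))
      = (\<lambda>u. ennreal (surface_element \<phi> u) * indicator U u)"
    by (auto simp: indicator_def)
  finally show ?thesis .
qed

lemma measurable_parametrization:
  assumes "(U, \<phi>) \<in> local_parametrizations S"
  shows "\<phi> \<in> borel_measurable (restrict_space lborel U)"
    "surface_element \<phi> \<in> borel_measurable (restrict_space lborel U)"
proof -
  note U = local_parametrizationsD[OF assms]
  have eq: "borel_measurable (restrict_space lborel U) = borel_measurable (restrict_space borel U)"
    by (intro measurable_cong_sets sets_restrict_space_cong) auto
  show "\<phi> \<in> borel_measurable (restrict_space lborel U)"
    "surface_element \<phi> \<in> borel_measurable (restrict_space lborel U)"
    unfolding eq
    using U(3) continuous_on_surface_element[OF U(2)]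
    by (auto intro!: borel_measurable_continuous_on_restrict)
qed

lemma parametrization_vimage_borel:
  assumes "(U, \<phi>) \<in> local_parametrizations S" and "A \<in> sets borel"
  shows "U \<inter> \<phi> -` A \<in> sets borel"
proof -
  note U = local_parametrizationsD[OF assms(1)]
  have "\<phi> \<in> borel_measurable (restrict_space borel U)"
    by (rule borel_measurable_continuous_on_restrict[OF U(3)])
  from measurable_sets[OF this assms(2)] have "\<phi> -` A \<inter> U \<in> sets (restrict_space borel U)"
    by (simp add: space_restrict_space)
  then show ?thesis
    using U(1) by (auto simp: sets_restrict_space_iff Int_commute)
qed

lemma emeasure_patch_measure:
  assumes lp: "(U, \<phi>) \<in> local_parametrizations S" and A: "A \<in> sets borel"
  shows "emeasure (patch_measure U \<phi>) A =
     emeasure (density lborel (\<lambda>u. ennreal (surface_element \<phi> u) * indicator U u)) (U \<inter> \<phi> -` A)"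
proof -
  note U = local_parametrizationsD[OF lp]
  note [measurable] = measurable_parametrization[OF lp] measurable_surface_element[OF lp]
    parametrization_vimage_borel[OF lp A]
  let ?R = "restrict_space lborel U"
  have "\<phi> -` A \<inter> U \<in> sets ?R"
    using measurable_sets[OF measurable_parametrization(1)[OF lp] A] by (simp add: space_restrict_space)
  then have "emeasure (patch_measure U \<phi>) A
      = (\<integral>\<^sup>+u. ennreal (surface_element \<phi> u) * indicator (\<phi> -` A \<inter> U) u \<partial>?R)"
    unfolding patch_measure_def using A
    by (subst emeasure_distr) (auto simp: emeasure_density space_restrict_space)
  also have "\<dots> = (\<integral>\<^sup>+u. ennreal (surface_element \<phi> u) * indicator U u * indicator (U \<inter> \<phi> -` A) u \<partial>lborel)"
    using U(1) by (subst nn_integral_restrict_space)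
      (auto intro!: nn_integral_cong simp: indicator_def)
  also have "\<dots> = emeasure (density lborel (\<lambda>u. ennreal (surface_element \<phi> u) * indicator U u)) (U \<inter> \<phi> -` A)"
    using parametrization_vimage_borel[OF lp A] by (subst emeasure_density) auto
  finally show ?thesis .
qed

text \<open>The subsets of \<open>T\<close> on which the norm of the argument and the integrand are at most \<open>n\<close> exhaust \<open>T\<close>. On each
  of them the integrand is absolutely integrable, so that the change of variables formula for
  such functions applies, and both integrals may be infinite in the limit.\<close>

lemma nn_integral_change_of_variables_le:
  fixes \<theta> :: "real^'m::{finite,wellorder} \<Rightarrow> real^'m::_" and f :: "real^'m::_ \<Rightarrow> real"
  assumes T: "T \<in> sets borel" and inj: "inj_on \<theta> T"
    and der: "\<And>u. u \<in> T \<Longrightarrow> (\<theta> has_derivative \<theta>' u) (at u)"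
    and meas: "(\<lambda>u. indicator T u * (\<bar>det (matrix (\<theta>' u))\<bar> * f (\<theta> u))) \<in> borel_measurable borel"
    and f0: "\<And>v. f v \<ge> 0" and B: "\<theta> ` T \<subseteq> B"
  shows "(\<integral>\<^sup>+u. ennreal (\<bar>det (matrix (\<theta>' u))\<bar> * f (\<theta> u)) * indicator T u \<partial>lborel)
     \<le> (\<integral>\<^sup>+v. ennreal (f v) * indicator B v \<partial>lborel)"
proof -
  define j where "j u = \<bar>det (matrix (\<theta>' u))\<bar> * f (\<theta> u)" for u
  define J where "J u = indicator T u * j u" for u
  have J[measurable]: "J \<in> borel_measurable borel"
    using meas by (simp add: J_def[abs_def] j_def)
  have J0: "J u \<ge> 0" and j0: "j u \<ge> 0" for u by (auto simp: J_def j_def f0)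
  define Tn where "Tn n = T \<inter> cball 0 (real n) \<inter> {u. J u \<le> real n}" for n
  have Tn[measurable]: "Tn n \<in> sets borel" for n
    unfolding Tn_def using T by measurable
  have bound: "(\<integral>\<^sup>+u. ennreal (j u) * indicator (Tn n) u \<partial>lborel)
      \<le> (\<integral>\<^sup>+v. ennreal (f v) * indicator B v \<partial>lborel)" for n
  proof -
    have fin: "emeasure lborel (Tn n) < \<infinity>"
    proof (rule order_le_less_trans)
      show "emeasure lborel (Tn n) \<le> emeasure lborel (cball (0 :: real^'m::_) (real n))"
        by (rule emeasure_mono) (auto simp: Tn_def)
    qed (rule emeasure_lborel_cball_finite)
    have "integrable lborel (\<lambda>u. indicator (Tn n) u *\<^sub>R J u)"
    proof (rule integrableI_bounded_set[where A = "Tn n" and B = "real n"])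
      show "(\<lambda>u. indicator (Tn n) u *\<^sub>R J u) \<in> borel_measurable lborel" by measurable
      show "AE u in lborel. u \<in> Tn n \<longrightarrow> norm (indicator (Tn n) u *\<^sub>R J u) \<le> real n"
        using J0 by (auto simp: Tn_def indicator_def)
    qed (use fin Tn in auto)
    also have "(\<lambda>u. indicator (Tn n) u *\<^sub>R J u) = (\<lambda>u. indicator (Tn n) u *\<^sub>R j u)"
      by (auto simp: Tn_def J_def indicator_def)
    finally have L: "integrable lborel (\<lambda>u. indicator (Tn n) u *\<^sub>R j u)" .
    then have ai: "j absolutely_integrable_on Tn n"
      using integrable_completion[OF borel_measurable_integrable[OF L]] by (simp add: set_integrable_def)
    have leb: "Tn n \<in> sets lebesgue"
      using Tn by (intro sets_completionI_sets) simp
    have der': "(\<theta> has_derivative \<theta>' u) (at u within Tn n)" if "u \<in> Tn n" for u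
      using that by (auto simp: Tn_def intro: has_derivative_at_withinI[OF der])
    have inj': "inj_on \<theta> (Tn n)"
      using inj by (rule inj_on_subset) (auto simp: Tn_def)
    \<comment> \<open>Real functions become functions into \<open>\<real>\<^sup>1\<close>, as the change of variables formula is about
      vector-valued functions.\<close>
    let ?vec = "\<lambda>x::real. (vec x :: real^1)"
    have "(\<lambda>u. \<bar>det (matrix (\<theta>' u))\<bar> *\<^sub>R ?vec (f (\<theta> u))) absolutely_integrable_on Tn n \<and>
          integral (Tn n) (\<lambda>u. \<bar>det (matrix (\<theta>' u))\<bar> *\<^sub>R ?vec (f (\<theta> u))) = ?vec (integral (Tn n) j)"
      using ai by (simp add: absolutely_integrable_on_1_iff integral_on_1_eq j_def[symmetric])
    then have "(\<lambda>v. ?vec (f v)) absolutely_integrable_on \<theta> ` Tn n \<and>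
          integral (\<theta> ` Tn n) (\<lambda>v. ?vec (f v)) = ?vec (integral (Tn n) j)"
      using has_absolute_integral_change_of_variables[where f = "\<lambda>v. ?vec (f v)" and b = "?vec (integral (Tn n) j)", OF leb der' inj'] by simp
    then have I: "f absolutely_integrable_on \<theta> ` Tn n" "integral (\<theta> ` Tn n) f = integral (Tn n) j"
      by (simp_all add: absolutely_integrable_on_1_iff integral_on_1_eq)
    then have hi: "(f has_integral integral (Tn n) j) (\<theta> ` Tn n)"
      using set_lebesgue_integral_eq_integral(1) integrable_integral by metis
    have hj: "(j has_integral integral (Tn n) j) (Tn n)"
      using ai set_lebesgue_integral_eq_integral(1) integrable_integral by metis
    have "(\<integral>\<^sup>+u. ennreal (j u) * indicator (Tn n) u \<partial>lborel) = ennreal (integral (Tn n) j)"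
      by (rule nn_integral_has_integral_lebesgue'[OF j0 hj])
    also have "\<dots> = (\<integral>\<^sup>+v. ennreal (f v) * indicator (\<theta> ` Tn n) v \<partial>lborel)"
      by (rule nn_integral_has_integral_lebesgue'[OF f0 hi, symmetric])
    also have "\<dots> \<le> (\<integral>\<^sup>+v. ennreal (f v) * indicator B v \<partial>lborel)"
      using B by (intro nn_integral_mono) (auto simp: indicator_def Tn_def)
    finally show ?thesis .
  qed
  have "incseq Tn"
    by (rule incseq_SucI) (auto simp: Tn_def)
  have UTn: "(\<Union>n. Tn n) = T"
  proof safe
    fix u assume "u \<in> T"
    obtain n where "max (norm u) (J u) \<le> real n"
      using real_arch_simple by blast
    then show "u \<in> (\<Union>n. Tn n)"
      using \<open>u \<in> T\<close> by (auto simp: Tn_def)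
  qed (auto simp: Tn_def)
  let ?D = "density lborel (\<lambda>u. ennreal (J u))"
  have eD: "emeasure ?D A = (\<integral>\<^sup>+u. ennreal (j u) * indicator A u \<partial>lborel)"
    if "A \<in> sets borel" "A \<subseteq> T" for A
  proof -
    have "(\<lambda>u. ennreal (J u)) \<in> borel_measurable lborel" by measurable
    then have "emeasure ?D A = (\<integral>\<^sup>+u. ennreal (J u) * indicator A u \<partial>lborel)"
      using that by (intro emeasure_density) auto
    also have "\<dots> = (\<integral>\<^sup>+u. ennreal (j u) * indicator A u \<partial>lborel)"
      using that by (intro nn_integral_cong) (auto simp: J_def indicator_def)
    finally show ?thesis .
  qed
  have "(\<integral>\<^sup>+u. ennreal (j u) * indicator T u \<partial>lborel) = (SUP n. emeasure ?D (Tn n))"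
    using SUP_emeasure_incseq[of Tn ?D, OF _ \<open>incseq Tn\<close>] eD[OF T order_refl]
    by (simp add: UTn image_subset_iff Tn)
  also have "\<dots> \<le> (\<integral>\<^sup>+v. ennreal (f v) * indicator B v \<partial>lborel)"
  proof (rule SUP_least)
    have "Tn n \<subseteq> T" for n by (auto simp: Tn_def)
    from eD[OF Tn this] bound
    show "emeasure ?D (Tn n) \<le> (\<integral>\<^sup>+v. ennreal (f v) * indicator B v \<partial>lborel)" for n
      by simp
  qed
  finally show ?thesis
    by (simp add: j_def)
qed

text \<open>The measure that equals \<open>M i0\<close> plus infinite mass outside \<open>C\<close> is an upper bound of the family, so
  the least upper bound cannot exceed \<open>M i0\<close> on subsets of \<open>C\<close>.\<close>

lemma emeasure_SUP_dominated:
  fixes M :: "'i \<Rightarrow> 'a measure"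
  assumes i0: "i0 \<in> I" and sets: "\<And>i. i \<in> I \<Longrightarrow> sets (M i) = sets N"
    and dom: "\<And>i A. i \<in> I \<Longrightarrow> A \<in> sets N \<Longrightarrow> A \<subseteq> C \<Longrightarrow> emeasure (M i) A \<le> emeasure (M i0) A"
    and A: "A \<in> sets N" "A \<subseteq> C"
  shows "emeasure (SUP i\<in>I. M i) A = emeasure (M i0) A"
proof (rule antisym)
  define \<mu> where "\<mu> A = emeasure (M i0) A + (if A \<subseteq> C then 0 else top)" for A
  define \<nu> where "\<nu> = measure_of (space N) (sets N) \<mu>"
  have s\<nu>: "sets \<nu> = sets N" "space \<nu> = space N"
    by (auto simp: \<nu>_def)
  have e\<nu>: "emeasure \<nu> A = \<mu> A" if "A \<in> sets N" for A
    unfolding \<nu>_def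
  proof (rule emeasure_measure_of_sigma[OF _ _ _ that])
    show "sigma_algebra (space N) (sets N)" by (rule sets.sigma_algebra_axioms)
    show "positive (sets N) \<mu>" by (simp add: positive_def \<mu>_def)
    show "countably_additive (sets N) \<mu>"
    proof (rule countably_additiveI)
      fix B :: "nat \<Rightarrow> 'a set"
      assume B: "range B \<subseteq> sets N" "disjoint_family B"
      have "(\<Sum>i. emeasure (M i0) (B i)) = emeasure (M i0) (\<Union>i. B i)"
        using B i0 sets by (intro suminf_emeasure) auto
      moreover have "(\<Sum>i. if B i \<subseteq> C then 0 else top :: ennreal) = (if (\<Union>i. B i) \<subseteq> C then 0 else top)"
      proof (cases "(\<Union>i. B i) \<subseteq> C")
        case True
        then show ?thesis by (auto simp: UN_subset_iff)
      next
        case False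
        then obtain i where "\<not> B i \<subseteq> C" by auto
        then have "(top::ennreal) \<le> (\<Sum>i. if B i \<subseteq> C then 0 else top)"
          using sum_le_suminf[of "\<lambda>i. if B i \<subseteq> C then 0 else top :: ennreal" "{i}"] by simp
        then show ?thesis using False by (simp add: top_unique)
      qed
      ultimately show "(\<Sum>i. \<mu> (B i)) = \<mu> (\<Union>i. B i)"
        unfolding \<mu>_def by (subst suminf_add[symmetric]) auto
    qed
  qed
  have "(SUP i\<in>I. M i) \<le> \<nu>"
  proof (rule SUP_least)
    fix i assume i: "i \<in> I"
    have "emeasure (M i) A \<le> emeasure \<nu> A" for A
    proof (cases "A \<in> sets N")
      case True
      then show ?thesis using dom[OF i True] by (auto simp: e\<nu> \<mu>_def)
    next
      case False
      then show ?thesis using i sets by (simp add: emeasure_notin_sets)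
    qed
    then show "M i \<le> \<nu>"
      using sets[OF i] s\<nu> sets_eq_imp_space_eq[OF sets[OF i]] by (auto simp: le_measure_iff le_fun_def)
  qed
  then have "emeasure (SUP i\<in>I. M i) A \<le> emeasure \<nu> A"
    using s\<nu> sets_SUP[of I M N] i0 sets by (intro le_measureD3) auto
  also have "\<dots> = emeasure (M i0) A"
    using A by (simp add: e\<nu> \<mu>_def)
  finally show "emeasure (SUP i\<in>I. M i) A \<le> emeasure (M i0) A" .
  have "M i0 \<le> (SUP i\<in>I. M i)"
    using i0 by (rule SUP_upper)
  then show "emeasure (M i0) A \<le> emeasure (SUP i\<in>I. M i) A"
    using sets_SUP[of I M N] i0 sets by (intro le_measureD3) auto
qed

section \<open>The surface measure on a graph patch\<close>

text \<open>A closed set \<open>S\<close> which is a graph inside the open set \<open>B\<close>.\<close>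

locale hypersurface_chart = graph_chart k e g
  for k :: "'n::finite" and e :: "'m::{finite,wellorder} \<Rightarrow> 'n" and g :: "real^'n \<Rightarrow> real" +
  fixes S B :: "(real^'n) set"
  assumes open_B: "open B" and closed_S: "closed S"
    and S_Int_B: "S \<inter> B = {x \<in> B. x $ k = g (base x)}"
begin

definition params :: "(real^'m::_) set" where "params = chart -` B"

lemma open_U: "open params"
  unfolding params_def using continuous_on_chart open_B by (rule open_vimage[rotated])

lemma chart_image_U: "chart ` params = S \<inter> B"
proof
  show "chart ` params \<subseteq> S \<inter> B" by (auto simp: params_def S_Int_B)
  show "S \<inter> B \<subseteq> chart ` params"
  proof
    fix x assume "x \<in> S \<inter> B"
    then have "chart (proj x) = x" "x \<in> B" by (auto simp: S_Int_B chart_proj)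
    then show "x \<in> chart ` params" by (auto simp: params_def intro!: image_eqI[of _ _ "proj x"])
  qed
qed

lemma chart_in_iff: "w \<in> params \<Longrightarrow> chart w \<in> S" "w \<in> params \<Longrightarrow> chart w \<in> B"
  using chart_image_U by auto

lemma S_Int_B_borel: "S \<inter> B \<in> sets borel"
  using open_B closed_S by auto

lemma chart_local_parametrization: "(params, chart) \<in> local_parametrizations S"
proof -
  have "homeomorphism params (chart ` params) chart proj"
    using continuous_on_chart linear_continuous_on[OF bounded_linear_proj]
    by (auto simp: homeomorphism_def image_image)
  moreover have "openin (top_of_set S) (chart ` params)"
    using open_B by (auto simp: chart_image_U openin_open)
  ultimately show ?thesis
    using open_U smooth_on_chart inj_FD_chart by (auto simp: local_parametrizations_def)
qed

text \<open>The transition map \<open>\<theta>\<close> from another parametrization to the graph chart is the composition of \<open>\<phi>\<close> with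
  a linear projection, and hence differentiable. Since \<open>\<phi> = chart \<circ> \<theta>\<close>, the Gram determinants of
  the two parametrizations differ by the square of the Jacobian determinant of \<open>\<theta>\<close>, and the change
  of variables formula compares the measures.\<close>

lemma patch_measure_le:
  fixes U' :: "(real^'m::_) set"
  assumes lp: "(U', \<phi>) \<in> local_parametrizations S"
    and A: "A \<in> sets borel" "A \<subseteq> S \<inter> B"
  shows "emeasure (patch_measure U' \<phi>) A \<le> emeasure (patch_measure params chart) A"
proof -
  note lpD = local_parametrizationsD[OF lp]
  define \<theta> where "\<theta> u = proj (\<phi> u)" for u
  define \<theta>' where "\<theta>' u v = proj (FD \<phi> u v)" for u v
  define T where "T = U' \<inter> \<phi> -` A"
  have T: "T \<in> sets borel"
    unfolding T_def by (rule parametrization_vimage_borel[OF lp A(1)])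
  have open_T': "open (U' \<inter> \<phi> -` B)"
    using continuous_open_preimage[OF lpD(3,1) open_B] .
  have chart_\<theta>: "chart (\<theta> u) = \<phi> u" "\<theta> u \<in> params" if "u \<in> U' \<inter> \<phi> -` B" for u
  proof -
    have "\<phi> u \<in> S \<inter> B" using that lpD(5) by auto
    then show "chart (\<theta> u) = \<phi> u" by (auto simp: \<theta>_def S_Int_B chart_proj)
    then show "\<theta> u \<in> params" using that by (auto simp: params_def)
  qed
  have T': "T \<subseteq> U' \<inter> \<phi> -` B" using A(2) by (auto simp: T_def)
  have der: "(\<theta> has_derivative \<theta>' u) (at u)" if "u \<in> U'" for u
    unfolding \<theta>_def[abs_def] \<theta>'_def[abs_def]
    by (rule bounded_linear.has_derivative[OF bounded_linear_proj lpD(6)[OF that]])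
  have surf: "surface_element \<phi> u = \<bar>det (matrix (\<theta>' u))\<bar> * surface_element chart (\<theta> u)" if "u \<in> T" for u
  proof -
    have u: "u \<in> U' \<inter> \<phi> -` B" using T' that by auto
    have "(chart has_derivative FD chart (\<theta> u)) (at (\<theta> u))"
      using C1_on_has_derivative[OF Ck_on_chart] by blast
    from has_derivative_compose[OF der this] u
    have "((\<lambda>u. chart (\<theta> u)) has_derivative (\<lambda>v. FD chart (\<theta> u) (\<theta>' u v))) (at u)"
      by auto
    then have "(\<phi> has_derivative (\<lambda>v. FD chart (\<theta> u) (\<theta>' u v))) (at u)"
      by (rule has_derivative_transform_within_open[OF _ open_T' u]) (simp add: chart_\<theta>)
    then have "FD \<phi> u = FD chart (\<theta> u) \<circ> \<theta>' u"
      using frechet_derivative_at by (fastforce simp: o_def)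
    moreover have "linear (\<theta>' u)" "linear (FD chart (\<theta> u))"
      using has_derivative_linear[OF der] u has_derivative_chart[of "\<theta> u"]
      by (auto simp: FD_chart[abs_def] dest: has_derivative_linear)
    ultimately have "jacobian \<phi> (at u) = jacobian chart (at (\<theta> u)) ** matrix (\<theta>' u)"
      unfolding jacobian_def by (simp add: matrix_compose)
    then have "det (transpose (jacobian \<phi> (at u)) ** jacobian \<phi> (at u)) = (det (matrix (\<theta>' u)))\<^sup>2
       * det (transpose (jacobian chart (at (\<theta> u))) ** jacobian chart (at (\<theta> u)))"
      by (simp add: matrix_transpose_mul matrix_mul_assoc[symmetric] det_mul power2_eq_square)
        (simp add: matrix_mul_assoc det_mul)
    then show ?thesis
      by (simp add: surface_element_def real_sqrt_mult)
  qed
  have inj: "inj_on \<theta> T"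
  proof (rule inj_onI)
    fix x y assume xy: "x \<in> T" "y \<in> T" "\<theta> x = \<theta> y"
    then have "\<phi> x = \<phi> y" using chart_\<theta>(1) T' by (metis subsetD)
    then show "x = y" using xy lpD(4) by (auto simp: T_def inj_on_def)
  qed
  have "(\<lambda>u. indicator T u * (\<bar>det (matrix (\<theta>' u))\<bar> * surface_element chart (\<theta> u)))
      = (\<lambda>u. indicator T u *\<^sub>R (indicator U' u *\<^sub>R surface_element \<phi> u))"
    using surf by (auto simp: indicator_def T_def)
  moreover have "(\<lambda>u. indicator U' u *\<^sub>R surface_element \<phi> u) \<in> borel_measurable borel"
    using lpD(1) continuous_on_surface_element[OF lpD(2)]
    by (intro borel_measurable_continuous_on_indicator) auto
  ultimately have meas: "(\<lambda>u. indicator T u * (\<bar>det (matrix (\<theta>' u))\<bar> * surface_element chart (\<theta> u)))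
      \<in> borel_measurable borel"
    using T by simp
  let ?V = "params \<inter> chart -` A"
  have "emeasure (patch_measure U' \<phi>) A = (\<integral>\<^sup>+u. ennreal (surface_element \<phi> u) * indicator U' u * indicator T u \<partial>lborel)"
    using T measurable_surface_element[OF lp]
    by (subst emeasure_patch_measure[OF lp A(1)]) (simp add: T_def emeasure_density)
  also have "\<dots> = (\<integral>\<^sup>+u. ennreal (\<bar>det (matrix (\<theta>' u))\<bar> * surface_element chart (\<theta> u)) * indicator T u \<partial>lborel)"
    using surf by (intro nn_integral_cong) (auto simp: indicator_def T_def)
  also have "\<dots> \<le> (\<integral>\<^sup>+v. ennreal (surface_element chart v) * indicator ?V v \<partial>lborel)"
  proof (rule nn_integral_change_of_variables_le[OF T inj _ meas])
    show "(\<theta> has_derivative \<theta>' u) (at u)" if "u \<in> T" for u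
      using der that by (auto simp: T_def)
    show "0 \<le> surface_element chart v" for v
      by (simp add: surface_element_chart)
    show "\<theta> ` T \<subseteq> params \<inter> chart -` A"
    proof
      fix w assume "w \<in> \<theta> ` T"
      then obtain u where u: "u \<in> T" "w = \<theta> u" by auto
      then show "w \<in> params \<inter> chart -` A"
        using chart_\<theta>[of u] T' by (auto simp: T_def)
    qed
  qed
  also have "\<dots> = (\<integral>\<^sup>+v. ennreal (surface_element chart v) * indicator params v * indicator ?V v \<partial>lborel)"
    by (intro nn_integral_cong) (auto simp: indicator_def)
  also have "\<dots> = emeasure (patch_measure params chart) A"
    using measurable_surface_element[OF chart_local_parametrization]
      parametrization_vimage_borel[OF chart_local_parametrization A(1)]
    by (subst emeasure_patch_measure[OF chart_local_parametrization A(1)]) (simp add: emeasure_density)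
  finally show ?thesis .
qed

lemma sets_surface_measure: "sets (surface_measure TYPE('m) S) = sets borel"
  unfolding surface_measure_def
  using chart_local_parametrization
  by (intro sets_SUP) auto

lemma emeasure_surface_measure:
  assumes "A \<in> sets borel" "A \<subseteq> S \<inter> B"
  shows "emeasure (surface_measure TYPE('m) S) A = emeasure (patch_measure params chart) A"
  unfolding surface_measure_def
  using emeasure_SUP_dominated[of "(params, chart)" "local_parametrizations S" "\<lambda>(V, \<phi>). patch_measure V \<phi>"
    borel "S \<inter> B" A] chart_local_parametrization patch_measure_le assms
  by auto

lemma density_surface_measure:
  "density (surface_measure TYPE('m) S) (indicator (S \<inter> B)) = patch_measure params chart"
proof (rule measure_eqI)
  let ?\<mu> = "surface_measure TYPE('m) S"
  fix A assume "A \<in> sets (density ?\<mu> (indicator (S \<inter> B)))"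
  then have A: "A \<in> sets borel" by (simp add: sets_surface_measure)
  have C: "S \<inter> B \<in> sets ?\<mu>" using S_Int_B_borel by (simp add: sets_surface_measure)
  have "emeasure (density ?\<mu> (indicator (S \<inter> B))) A = (\<integral>\<^sup>+x. indicator (S \<inter> B) x * indicator A x \<partial>?\<mu>)"
    using A C by (intro emeasure_density borel_measurable_indicator) (simp_all add: sets_surface_measure)
  also have "\<dots> = (\<integral>\<^sup>+x. indicator (S \<inter> B \<inter> A) x \<partial>?\<mu>)"
    by (simp add: indicator_inter_arith)
  also have "\<dots> = emeasure ?\<mu> (S \<inter> B \<inter> A)"
    using A C by (intro nn_integral_indicator) (auto simp: sets_surface_measure)
  also have "\<dots> = emeasure (patch_measure params chart) (S \<inter> B \<inter> A)"
    using A S_Int_B_borel by (intro emeasure_surface_measure) auto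
  also have "\<dots> = emeasure (patch_measure params chart) A"
  proof -
    have "params \<inter> chart -` (S \<inter> B \<inter> A) = params \<inter> chart -` A"
      using chart_in_iff by auto
    then show ?thesis
      using A S_Int_B_borel by (simp add: emeasure_patch_measure[OF chart_local_parametrization])
  qed
  finally show "emeasure (density ?\<mu> (indicator (S \<inter> B))) A = emeasure (patch_measure params chart) A" .
qed (simp add: sets_surface_measure)

text \<open>Integration over \<open>S\<close> in the chart, for a function that vanishes on \<open>S\<close> outside the patch. The
  function \<open>G\<close> is the pulled back integrand including the surface element; its continuity makes
  \<open>F\<close> measurable along \<open>S\<close>.\<close>

lemma set_integral_surface_measure:
  fixes F :: "real^'n \<Rightarrow> real"
  assumes F: "\<And>w. w \<in> params \<Longrightarrow> surface_element chart w * F (chart w) = G w"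
    and G: "continuous_on params G" and intG: "integrable lborel (\<lambda>w. indicator params w *\<^sub>R G w)"
    and F0: "\<And>x. x \<in> S \<Longrightarrow> x \<notin> B \<Longrightarrow> F x = 0"
  shows "set_integrable (surface_measure TYPE('m) S) S F"
    and "(LINT x:S|surface_measure TYPE('m) S. F x) = (LINT w|lborel. indicator params w *\<^sub>R G w)"
proof -
  let ?\<mu> = "surface_measure TYPE('m) S"
  let ?R = "restrict_space lborel params"
  define H where "H x = indicator (S \<inter> B) x *\<^sub>R F x" for x
  have pos: "surface_element chart w > 0" for w
    by (simp add: surface_element_chart add_pos_nonneg)
  have proj_U: "proj x \<in> params" "chart (proj x) = x" if "x \<in> S \<inter> B" for x
    using that chart_image_U proj_chart by (metis image_iff)+
  have cont: "continuous_on (S \<inter> B) (\<lambda>x. G (proj x) / surface_element chart (proj x))"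
  proof (intro continuous_on_divide)
    have p: "continuous_on (S \<inter> B) proj" "proj ` (S \<inter> B) \<subseteq> params"
      using proj_U by (auto intro: linear_continuous_on[OF bounded_linear_proj])
    show "continuous_on (S \<inter> B) (\<lambda>x. G (proj x))"
      by (rule continuous_on_compose2[OF G p])
    show "continuous_on (S \<inter> B) (\<lambda>x. surface_element chart (proj x))"
      by (rule continuous_on_compose2[OF continuous_on_surface_element[OF Ck_on_chart] p])
    show "\<forall>x\<in>S \<inter> B. surface_element chart (proj x) \<noteq> 0"
      using pos by (metis less_irrefl)
  qed
  have "F x = G (proj x) / surface_element chart (proj x)" if "x \<in> S \<inter> B" for x
    using F[OF proj_U(1)[OF that]] proj_U(2)[OF that] pos[of "proj x"] by (simp add: field_simps)
  then have "H = (\<lambda>x. indicator (S \<inter> B) x *\<^sub>R (G (proj x) / surface_element chart (proj x)))"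
    by (auto simp: H_def indicator_def fun_eq_iff)
  then have Hm[measurable]: "H \<in> borel_measurable borel"
    using borel_measurable_continuous_on_indicator[OF S_Int_B_borel cont] by simp
  have H\<mu>: "H \<in> borel_measurable ?\<mu>"
    using Hm by (simp add: measurable_cong_sets[OF sets_surface_measure refl])
  have C\<mu>: "(indicator (S \<inter> B) :: _ \<Rightarrow> real) \<in> borel_measurable ?\<mu>"
    using S_Int_B_borel by (intro borel_measurable_indicator) (simp add: sets_surface_measure)
  have eq1: "(\<lambda>x. indicator S x *\<^sub>R F x) = H"
    using F0 by (auto simp: H_def indicator_def fun_eq_iff)
  have HH: "(\<lambda>x. indicator (S \<inter> B) x *\<^sub>R H x) = H"
    by (auto simp: H_def indicator_def fun_eq_iff)
  have dens: "density ?\<mu> (\<lambda>x. ennreal (indicator (S \<inter> B) x)) = patch_measure params chart"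
    using density_surface_measure by (simp add: ennreal_indicator)
  note mp = measurable_parametrization[OF chart_local_parametrization]
  have mp1: "chart \<in> measurable (density ?R (\<lambda>u. ennreal (surface_element chart u))) borel"
    using mp(1) by simp
  have Hc: "(\<lambda>u. H (chart u)) \<in> borel_measurable ?R"
    using measurable_compose[OF mp(1) Hm] .
  have pull: "indicator params u *\<^sub>R (surface_element chart u *\<^sub>R H (chart u)) = indicator params u *\<^sub>R G u" for u
    using chart_in_iff[of u] F[of u] by (auto simp: indicator_def H_def)
  have UR: "params \<inter> space lborel \<in> sets lborel" using open_U by simp
  have nn: "AE x in ?R. 0 \<le> surface_element chart x"
    using pos by (simp add: less_imp_le)
  have "integrable ?\<mu> H \<longleftrightarrow> integrable (patch_measure params chart) H"
    unfolding dens[symmetric] by (subst integrable_density[OF H\<mu> C\<mu>]) (auto simp: HH[simplified])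
  also have "\<dots> \<longleftrightarrow> integrable lborel (\<lambda>w. indicator params w *\<^sub>R G w)"
    unfolding patch_measure_def integrable_distr_eq[OF mp1 Hm] integrable_density[OF Hc mp(2) nn]
      integrable_restrict_space[OF UR] pull ..
  finally show "set_integrable ?\<mu> S F"
    using intG by (simp only: set_integrable_def eq1)
  have "integral\<^sup>L ?\<mu> H = integral\<^sup>L (patch_measure params chart) H"
    unfolding dens[symmetric] by (subst integral_density[OF H\<mu> C\<mu>]) (auto simp: HH[simplified])
  also have "\<dots> = (LINT w|lborel. indicator params w *\<^sub>R G w)"
    unfolding patch_measure_def integral_distr[OF mp1 Hm] integral_density[OF Hc mp(2) nn]
      integral_restrict_space[OF UR] pull ..
  finally show "(LINT x:S|?\<mu>. F x) = (LINT w|lborel. indicator params w *\<^sub>R G w)"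
    by (simp only: set_lebesgue_integral_def eq1)
qed

end

section \<open>Normal vectors and tangential derivatives on the boundary\<close>

text \<open>A derivative relative to \<open>S\<close> determines the velocity of \<open>f\<close> along every curve that stays in \<open>S\<close>.
  This makes the choice hidden in \<open>frechet_derivative\<close> relative to a hypersurface harmless.\<close>

lemma has_derivative_eq_on_tangent_space:
  assumes F: "(f has_derivative F) (at x within S)" and G: "(f has_derivative G) (at x within S)"
    and v: "v \<in> tangent_space S x"
  shows "F v = G v"
proof -
  obtain c where c: "c 0 = x" "\<forall>\<^sub>F t in nhds 0. c t \<in> S" "(c has_vector_derivative v) (at 0)"
    using v by (auto simp: tangent_space_def)
  define T where "T = {t. c t \<in> S}"
  have "0 \<in> interior T"
    using c(2) by (auto simp: T_def eventually_nhds interior_def)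
  then have T: "at 0 within T = at 0"
    by (rule at_within_interior)
  have "(c has_derivative (\<lambda>t. t *\<^sub>R v)) (at 0 within T)"
    using c(3) T by (simp add: has_vector_derivative_def)
  moreover have "(f has_derivative F) (at (c 0) within c ` T)" "(f has_derivative G) (at (c 0) within c ` T)"
    using F G c(1) by (auto intro: has_derivative_subset simp: T_def)
  ultimately have "((\<lambda>t. f (c t)) has_derivative (\<lambda>t. F (t *\<^sub>R v))) (at 0 within T)"
    "((\<lambda>t. f (c t)) has_derivative (\<lambda>t. G (t *\<^sub>R v))) (at 0 within T)"
    by (auto intro: has_derivative_in_compose)
  then have "(\<lambda>t. F (t *\<^sub>R v)) = (\<lambda>t. G (t *\<^sub>R v))"
    unfolding T by (rule has_derivative_unique)
  from fun_cong[OF this, of 1] show ?thesis by simp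
qed

text \<open>The situation that \<open>smooth_boundary\<close> provides near a boundary point.\<close>

locale boundary_chart = graph_chart k e g
  for k :: "'n::finite" and e :: "'m::{finite,wellorder} \<Rightarrow> 'n" and g :: "real^'n \<Rightarrow> real" +
  fixes \<Omega> :: "(real^'n) set" and p :: "real^'n" and r s :: real
  assumes open_\<Omega>: "open \<Omega>" and s: "s \<in> {-1, 1}"
    and local_graph: "\<Omega> \<inter> ball p r = {x \<in> ball p r. s * (x $ k - g (\<chi> i. if i = k then 0 else x $ i)) > 0}"
begin

text \<open>A local defining function of \<open>\<Omega>\<close>: by \<open>in_\<Omega>_iff\<close> and \<open>in_frontier_iff\<close> its sign, up to the factor
  \<open>s\<close>, tells apart the inside, the boundary and the outside.\<close>

definition height :: "real^'n \<Rightarrow> real" where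
  "height x = x $ k - g (base x)"

text \<open>The gradient of the height function, a normal vector of length \<open>sqrt (1 + \<bar>\<nabla>g\<bar>\<^sup>2)\<close>.\<close>

definition conormal :: "real^'n \<Rightarrow> real^'n" where
  "conormal x = (\<chi> i. if i = k then 1 else - FD g (base x) (axis i 1))"

lemma in_\<Omega>_iff: "x \<in> ball p r \<Longrightarrow> x \<in> \<Omega> \<longleftrightarrow> s * height x > 0"
  using local_graph unfolding height_def base_def by blast

lemma ss [simp]: "s * s = 1" "s * (s * y) = y" "s \<noteq> 0"
  using s by auto

lemma inner_conormal: "conormal x \<bullet> v = v $ k - FD g (base x) (base v)"
proof -
  have base: "base v = (\<Sum>i\<in>-{k}. v $ i *\<^sub>R axis i 1)"
  proof -
    have "(\<Sum>i\<in>-{k}. v $ i *\<^sub>R axis i (1::real)) $ j = base v $ j" for j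
      by (simp add: base_def axis_def if_distrib cong: if_cong)
    then show ?thesis by (simp add: vec_eq_iff)
  qed
  have "conormal x \<bullet> v = (\<Sum>i\<in>UNIV. conormal x $ i * v $ i)"
    by (simp add: inner_vec_def)
  also have "\<dots> = v $ k + (\<Sum>i\<in>-{k}. conormal x $ i * v $ i)"
    by (subst sum.remove[of _ k]) (auto simp: conormal_def Compl_eq_Diff_UNIV)
  also have "(\<Sum>i\<in>-{k}. conormal x $ i * v $ i) = - FD g (base x) (base v)"
    unfolding base linear_sum[OF linear_FD_g] linear_scale[OF linear_FD_g] sum_negf[symmetric]
    by (intro sum.cong) (auto simp: conormal_def)
  finally show ?thesis by simp
qed

lemma has_derivative_height: "(height has_derivative (\<lambda>v. conormal x \<bullet> v)) (at x)"
proof -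
  have "((\<lambda>x. g (base x)) has_derivative (\<lambda>v. FD g (base x) (base v))) (at x)"
    by (rule has_derivative_compose[OF bounded_linear_imp_has_derivative[OF bounded_linear_base] has_derivative_g])
  moreover have "((\<lambda>x. x $ k) has_derivative (\<lambda>v. v $ k)) (at x)"
    by (rule bounded_linear_imp_has_derivative[OF bounded_linear_vec_nth])
  ultimately show ?thesis
    unfolding inner_conormal height_def[abs_def] by (rule has_derivative_diff[rotated])
qed

lemma continuous_on_height: "continuous_on A height"
  using has_derivative_height has_derivative_continuous continuous_at_imp_continuous_on by blast

lemma height_add_axis: "height (x + c *\<^sub>R axis k 1) = height x + c"
proof -
  have "base (x + c *\<^sub>R axis k 1) = base x"
    by (auto simp: base_def axis_def vec_eq_iff)
  then show ?thesis by (simp add: height_def)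
qed

lemma notin_closure:
  assumes "x \<in> ball p r" "s * height x < 0" shows "x \<notin> closure \<Omega>"
proof -
  let ?W = "ball p r \<inter> {x. s * height x < 0}"
  have "open ?W"
    by (intro open_Int open_ball open_Collect_less continuous_intros continuous_on_height)
  moreover have "?W \<inter> \<Omega> = {}"
    using in_\<Omega>_iff by force
  ultimately have "?W \<inter> closure \<Omega> = {}"
    by (simp add: open_Int_closure_eq_empty)
  then show ?thesis using assms by auto
qed

lemma in_frontier_iff:
  assumes x: "x \<in> ball p r" shows "x \<in> frontier \<Omega> \<longleftrightarrow> height x = 0"
proof
  assume "x \<in> frontier \<Omega>"
  then have "x \<in> closure \<Omega>" "x \<notin> \<Omega>"
    using open_\<Omega> by (auto simp: frontier_def interior_open)
  then have "s * height x = 0"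
    using notin_closure[OF x] in_\<Omega>_iff[OF x] by fastforce
  then show "height x = 0" by simp
next
  assume h: "height x = 0"
  have "\<exists>y\<in>\<Omega>. dist y x < d" if "d > 0" for d
  proof -
    define t where "t = min (d / 2) ((r - dist p x) / 2)"
    have t: "t > 0" "t < d" "t < r - dist p x" using that x by (auto simp: t_def min_def)
    let ?y = "x + (s * t) *\<^sub>R axis k 1"
    have dy: "dist ?y x = t" using t s by (auto simp: dist_norm)
    have "dist p ?y \<le> dist p x + dist ?y x"
      by (metis dist_commute dist_triangle)
    then have "?y \<in> ball p r" using dy t by auto
    moreover have "s * height ?y > 0"
      using t by (simp add: height_add_axis h)
    ultimately show ?thesis using in_\<Omega>_iff dy t by force
  qed
  then have "x \<in> closure \<Omega>" by (simp add: closure_approachable)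
  moreover have "x \<notin> \<Omega>" using in_\<Omega>_iff[OF x] h by simp
  ultimately show "x \<in> frontier \<Omega>"
    using open_\<Omega> by (auto simp: frontier_def interior_open)
qed

sublocale hypersurface_chart k e g "frontier \<Omega>" "ball p r"
proof
  show "frontier \<Omega> \<inter> ball p r = {x \<in> ball p r. x $ k = g (base x)}"
    using in_frontier_iff by (auto simp: height_def)
qed auto

text \<open>The height vanishes along curves in the boundary, which gives one direction. Conversely,
  the image under the chart of a straight line is a curve with the prescribed velocity.\<close>

lemma tangent_space_iff:
  assumes x: "x \<in> frontier \<Omega>" "x \<in> ball p r"
  shows "v \<in> tangent_space (frontier \<Omega>) x \<longleftrightarrow> conormal x \<bullet> v = 0"
proof
  assume v: "v \<in> tangent_space (frontier \<Omega>) x"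
  have "(height has_derivative (\<lambda>v. conormal x \<bullet> v)) (at x within frontier \<Omega>)"
    using has_derivative_height by (rule has_derivative_at_withinI)
  moreover have "(height has_derivative (\<lambda>v. 0)) (at x within frontier \<Omega>)"
  proof -
    have "((\<lambda>x. 0 :: real) has_derivative (\<lambda>v. 0)) (at x within frontier \<Omega>)"
      by simp
    moreover obtain d where d: "d > 0" "ball x d \<subseteq> ball p r"
      using x open_ball openE by blast
    ultimately show ?thesis
      using in_frontier_iff x
      by (elim has_derivative_transform_within[where d = d]) (auto simp: dist_commute subset_iff)
  qed
  ultimately show "conormal x \<bullet> v = 0"
    using v by (rule has_derivative_eq_on_tangent_space)
next
  assume v: "conormal x \<bullet> v = 0"
  define c where "c t = chart (proj x + t *\<^sub>R proj v)" for t
  have pU: "proj x \<in> params" "chart (proj x) = x"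
  proof -
    obtain w where "w \<in> params" "x = chart w"
      using x chart_image_U by blast
    then show "proj x \<in> params" "chart (proj x) = x" by simp_all
  qed
  have l: "((\<lambda>t. proj x + t *\<^sub>R proj v) has_derivative (\<lambda>t. t *\<^sub>R proj v)) (at 0)"
    by (auto intro!: derivative_eq_intros)
  from has_derivative_compose[OF l has_derivative_chart]
  have "(c has_derivative (\<lambda>t. FD chart (proj x) (t *\<^sub>R proj v))) (at 0)"
    by (simp add: c_def[abs_def] FD_chart)
  moreover have "FD chart (proj x) (t *\<^sub>R proj v) = t *\<^sub>R v" for t
  proof -
    have "emb (t *\<^sub>R proj v) = t *\<^sub>R base v" using linear_scale[OF linear_emb] by simp
    then have "FD chart (proj x) (t *\<^sub>R proj v) = t *\<^sub>R (base v + FD g (base x) (base v) *\<^sub>R axis k 1)"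
      by (simp add: FD_chart linear_scale[OF linear_FD_g] scaleR_add_right)
    also have "FD g (base x) (base v) = v $ k" using v by (simp add: inner_conormal)
    finally show ?thesis using axis_decompose[of v] by simp
  qed
  ultimately have "(c has_vector_derivative v) (at 0)"
    by (simp add: has_vector_derivative_def)
  moreover have "\<forall>\<^sub>F t in nhds 0. c t \<in> frontier \<Omega>"
  proof -
    have "isCont (\<lambda>t. proj x + t *\<^sub>R proj v) 0" by (intro continuous_intros)
    then have "\<forall>\<^sub>F t in nhds 0. proj x + t *\<^sub>R proj v \<in> params"
      using open_U pU by (auto simp: continuous_at_open eventually_nhds)
    then show ?thesis
      by (rule eventually_mono) (simp add: c_def chart_in_iff)
  qed
  moreover have "c 0 = x" by (simp add: c_def pU)
  ultimately show "v \<in> tangent_space (frontier \<Omega>) x"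
    by (auto simp: tangent_space_def)
qed

lemma conormal_nonzero: "conormal x \<noteq> 0"
proof
  assume "conormal x = 0"
  then have "conormal x $ k = 0" by simp
  then show False by (simp add: conormal_def)
qed

lemma eventually_height_ray:
  assumes x: "x \<in> frontier \<Omega>" "x \<in> ball p r" and pos: "s' * (conormal x \<bullet> v) > 0"
  shows "\<forall>\<^sub>F t in at_right 0. x + t *\<^sub>R v \<in> ball p r \<and> s' * height (x + t *\<^sub>R v) > 0"
proof (rule eventually_conj)
  have "((\<lambda>t. x + t *\<^sub>R v) \<longlongrightarrow> x) (at_right 0)"
    by (auto intro!: tendsto_eq_intros)
  then show "\<forall>\<^sub>F t in at_right 0. x + t *\<^sub>R v \<in> ball p r"
    using open_ball x(2) by (rule topological_tendstoD)
  have l: "((\<lambda>t. x + t *\<^sub>R v) has_derivative (\<lambda>t. t *\<^sub>R v)) (at 0)"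
    by (auto intro!: derivative_eq_intros)
  from has_derivative_mult_right[OF has_derivative_compose[OF l has_derivative_height], of s']
  have "((\<lambda>t. s' * height (x + t *\<^sub>R v)) has_real_derivative s' * (conormal x \<bullet> v)) (at 0)"
    by (simp add: has_field_derivative_def mult_commute_abs mult.left_commute)
  from DERIV_pos_inc_right[OF this pos] obtain d where
    "d > 0" "\<And>h. 0 < h \<Longrightarrow> h < d \<Longrightarrow> s' * height (x + h *\<^sub>R v) > 0"
    using in_frontier_iff[OF x(2)] x(1) by auto
  then show "\<forall>\<^sub>F t in at_right 0. s' * height (x + t *\<^sub>R v) > 0"
    by (auto simp: eventually_at_right)
qed

text \<open>A vector that annihilates the tangent space is a multiple of the conormal vector, because its
  component orthogonal to the conormal vector is tangent. The behaviour of the height along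
  the normal ray determines the sign.\<close>

lemma unit_normal_eq:
  assumes x: "x \<in> frontier \<Omega>" "x \<in> ball p r"
  shows "unit_normal \<Omega> x = (- s / norm (conormal x)) *\<^sub>R conormal x"
  unfolding unit_normal_def
proof (rule the_equality, intro conjI)
  let ?N = "conormal x"
  let ?n = "(- s / norm ?N) *\<^sub>R ?N"
  have N: "norm ?N > 0" "?N \<bullet> ?N > 0" using conormal_nonzero by auto
  show "norm ?n = 1" using N s by auto
  show "\<forall>v\<in>tangent_space (frontier \<Omega>) x. ?n \<bullet> v = 0"
    using tangent_space_iff[OF x] by simp
  have "s * (?N \<bullet> - ?n) > 0" "- s * (?N \<bullet> ?n) > 0"
    using N s by auto
  from eventually_height_ray[OF x this(1)] eventually_height_ray[OF x this(2)]
  show "\<forall>\<^sub>F t in at_right 0. x - t *\<^sub>R ?n \<in> \<Omega> \<and> x + t *\<^sub>R ?n \<notin> closure \<Omega>"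
  proof eventually_elim
    case (elim t)
    then show ?case using in_\<Omega>_iff[of "x + t *\<^sub>R - ?n"] notin_closure[of "x + t *\<^sub>R ?n"] by auto
  qed
next
  let ?N = "conormal x"
  fix \<nu> assume \<nu>: "norm \<nu> = 1 \<and> (\<forall>v\<in>tangent_space (frontier \<Omega>) x. \<nu> \<bullet> v = 0) \<and>
        (\<forall>\<^sub>F t in at_right 0. x - t *\<^sub>R \<nu> \<in> \<Omega> \<and> x + t *\<^sub>R \<nu> \<notin> closure \<Omega>)"
  have N: "norm ?N > 0" "?N \<bullet> ?N > 0" using conormal_nonzero by auto
  define c where "c = (\<nu> \<bullet> ?N) / (?N \<bullet> ?N)"
  define v where "v = \<nu> - c *\<^sub>R ?N"
  have Nv: "?N \<bullet> v = 0" using N by (simp add: v_def c_def inner_diff_right inner_commute)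
  then have "\<nu> \<bullet> v = 0" using \<nu> tangent_space_iff[OF x] by blast
  then have "v \<bullet> v = 0" using Nv by (subst (1) v_def) (simp add: inner_diff_left)
  then have \<nu>_eq: "\<nu> = c *\<^sub>R ?N" by (simp add: v_def)
  have "\<bar>c\<bar> * norm ?N = 1" using \<nu> \<nu>_eq by simp
  moreover have "\<not> s * c > 0"
  proof
    assume "s * c > 0"
    then have "- s * (?N \<bullet> - \<nu>) > 0" using N by (simp add: \<nu>_eq mult.assoc[symmetric])
    from eventually_height_ray[OF x this] \<nu>[THEN conjunct2, THEN conjunct2]
    have "\<forall>\<^sub>F t::real in at_right 0. False"
    proof eventually_elim
      case (elim t)
      then show ?case using in_\<Omega>_iff[of "x + t *\<^sub>R - \<nu>"] by auto
    qed
    then show False by (simp add: trivial_limit_at_right_real)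
  qed
  ultimately have "c = - s / norm ?N"
    using s N by (auto simp: field_simps abs_if split: if_splits)
  then show "\<nu> = (- s / norm ?N) *\<^sub>R ?N" using \<nu>_eq by simp
qed

lemma tangential_deriv_eq:
  assumes x: "x \<in> frontier \<Omega>" "x \<in> ball p r"
    and f: "(f has_derivative D) (at x)" and ff: "\<And>y. y \<in> frontier \<Omega> \<Longrightarrow> f' y = f y"
  shows "tangential_deriv \<Omega> i j f' x =
    D (unit_normal \<Omega> x $ i *\<^sub>R axis j 1 - unit_normal \<Omega> x $ j *\<^sub>R axis i 1)"
  unfolding tangential_deriv_def
proof (rule has_derivative_eq_on_tangent_space)
  show D: "(f' has_derivative D) (at x within frontier \<Omega>)"
    by (rule has_derivative_transform[OF x(1) ff has_derivative_at_withinI[OF f]])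
  then show "(f' has_derivative frechet_derivative f' (at x within frontier \<Omega>)) (at x within frontier \<Omega>)"
    by (auto simp: frechet_derivative_works[symmetric] differentiable_def)
  show "unit_normal \<Omega> x $ i *\<^sub>R axis j 1 - unit_normal \<Omega> x $ j *\<^sub>R axis i 1 \<in> tangent_space (frontier \<Omega>) x"
    unfolding tangent_space_iff[OF x] unit_normal_eq[OF x]
    by (simp add: inner_diff_right inner_axis)
qed

lemma norm_conormal: "norm (conormal (chart w)) = surface_element chart w"
proof -
  have "conormal (chart w) \<bullet> conormal (chart w) = 1 + (\<Sum>i\<in>-{k}. (FD g (emb w) (axis i 1))\<^sup>2)"
    unfolding inner_vec_def
    by (subst sum.remove[of _ k]) (auto simp: conormal_def Compl_eq_Diff_UNIV power2_eq_square intro!: sum.cong)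
  also have "(\<Sum>i\<in>-{k}. (FD g (emb w) (axis i 1))\<^sup>2) = slope w \<bullet> slope w"
    by (subst sum.reindex_bij_betw[OF bij, symmetric]) (simp add: inner_vec_def slope_def power2_eq_square)
  finally show ?thesis
    by (simp add: norm_eq_sqrt_inner surface_element_chart)
qed

end

section \<open>Integrals of tangential derivatives\<close>

context boundary_chart
begin

lemma has_derivative_chart_FD: "(chart has_derivative FD chart w) (at w)"
  using C1_on_has_derivative[OF Ck_on_chart[of _ UNIV]] by simp

text \<open>The local form of Stokes' theorem. In the proof, \<open>h\<close> is \<open>f\<close> in the parameter space, extended by
  zero, with derivative \<open>h'\<close>; the functions \<open>q b\<close> are the products \<open>h \<partial>\<^sub>bg\<close>, with derivatives \<open>q' b\<close>;
  and \<open>G\<close> is the integrand, including the surface element, in the parameter space.\<close>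

lemma integral_tangential_deriv_in_chart_eq_0:
  assumes ij: "i \<noteq> j" and V: "frontier \<Omega> \<subseteq> V" and f: "Ck_on (Suc 0) V f"
    and K: "compact K" "K \<subseteq> ball p r" and f0: "\<And>x. x \<in> V \<Longrightarrow> x \<notin> K \<Longrightarrow> f x = 0"
    and F0: "\<And>x. x \<in> frontier \<Omega> \<Longrightarrow> x \<notin> ball p r \<Longrightarrow> tangential_deriv \<Omega> i j f x = 0"
  shows "set_integrable (surface_measure TYPE('m) (frontier \<Omega>)) (frontier \<Omega>) (tangential_deriv \<Omega> i j f)"
    and "(LINT x:frontier \<Omega>|surface_measure TYPE('m) (frontier \<Omega>). tangential_deriv \<Omega> i j f x) = 0"
proof -
  define h where "h w = (if w \<in> params then f (chart w) else 0)" for w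
  define h' where "h' w v = (if w \<in> params then FD f (chart w) (FD chart w v) else 0)" for w v
  \<comment> \<open>A compact subset of the parameter domain outside of which \<open>h\<close> vanishes.\<close>
  define K' where "K' = proj ` (K \<inter> frontier \<Omega>)"
  have chartV: "chart w \<in> V" if "w \<in> params" for w
    using that chart_in_iff V by auto
  have der_f: "(f has_derivative FD f (chart w)) (at (chart w))" if "w \<in> params" for w
    using C1_on_has_derivative[OF f chartV[OF that]] .
  have lin_f: "linear (FD f (chart w))" if "w \<in> params" for w
    using der_f[OF that] has_derivative_linear by blast
  have "compact (K \<inter> frontier \<Omega>)"
    using K by (intro compact_Int_closed) auto
  then have K': "compact K'"
    unfolding K'_def by (intro compact_continuous_image linear_continuous_on bounded_linear_proj)
  have K'params: "K' \<subseteq> params"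
  proof
    fix w assume "w \<in> K'"
    then obtain x where x: "x \<in> frontier \<Omega> \<inter> ball p r" "w = proj x"
      using K by (auto simp: K'_def)
    then obtain w' where "w' \<in> params" "x = chart w'"
      using chart_image_U by blast
    then show "w \<in> params" using x by simp
  qed
  have h0: "h w = 0" if "w \<notin> K'" for w
  proof (cases "w \<in> params")
    case True
    have "chart w \<notin> K"
    proof
      assume "chart w \<in> K"
      then have "proj (chart w) \<in> K'"
        unfolding K'_def using chart_in_iff(1)[OF True] by blast
      then show False using that by simp
    qed
    then show ?thesis using f0 chartV[OF True] by (simp add: h_def)
  qed (simp add: h_def)
  have der_h: "(h has_derivative h' w) (at w)" for w
  proof (cases "w \<in> params")
    case True
    have "((\<lambda>w. f (chart w)) has_derivative (\<lambda>v. FD f (chart w) (FD chart w v))) (at w)"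
      by (rule has_derivative_compose[OF has_derivative_chart_FD der_f[OF True]])
    then have "(h has_derivative (\<lambda>v. FD f (chart w) (FD chart w v))) (at w)"
      by (rule has_derivative_transform_within_open[OF _ open_U True]) (simp add: h_def)
    then show ?thesis using True by (simp add: h'_def[abs_def])
  next
    case False
    have "((\<lambda>w. 0 :: real) has_derivative (\<lambda>v. 0)) (at w)"
      by simp
    then have "(h has_derivative (\<lambda>v. 0)) (at w)"
      by (rule has_derivative_transform_within_open[of _ _ _ _ "- K'"])
        (use False K'params h0 compact_imp_closed[OF K'] in auto)
    then show ?thesis using False by (simp add: h'_def[abs_def])
  qed
  have cont_FDf: "continuous_on params (\<lambda>w. FD f (chart w) v)" for v
    using C1_on_continuous_on_FD[OF f] continuous_on_chart
    by (rule continuous_on_compose2) (use chartV in auto)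
  have cont_emb: "continuous_on A emb" for A
    using linear_continuous_on[OF bounded_linear_emb] .
  have cont_FDg: "continuous_on A (\<lambda>w. FD g (emb w) v)" for v A
    using C1_on_continuous_on_FD[OF C1_g] cont_emb by (rule continuous_on_compose2) auto
  have h'_eq: "h' w v = FD f (chart w) (emb v) + FD g (emb w) (emb v) * FD f (chart w) (axis k 1)"
    if "w \<in> params" for w v
    using that by (simp add: h'_def FD_chart linear_add[OF lin_f] linear_scale[OF lin_f])
  have h'_axis: "h' w (axis l 1) = FD f (chart w) (axis (e l) 1) + slope w $ l * FD f (chart w) (axis k 1)"
    if "w \<in> params" for w l
    using h'_eq[OF that] by (simp add: emb_axis slope_def)
  have cont_h': "continuous_on params (\<lambda>w. h' w v)" for v
    by (subst continuous_on_cong[OF refl h'_eq]) (auto intro!: continuous_intros cont_FDf cont_FDg)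
  have h'0: "h' w v = 0" if "w \<notin> params" for w v
    using that by (simp add: h'_def)
  have int_h': "integrable lborel (\<lambda>w. h' w v)" "(LINT w|lborel. h' w v) = 0" for v
    by (rule integral_directional_derivative_compact_support[OF der_h K' _
        continuous_on_subset[OF cont_h' K'params]]; rule h0; assumption)+

  define D2 where "D2 b w v = FD (\<lambda>x. FD g x (axis (e b) 1)) (emb w) (emb v)" for b w v
  define q where "q b w = h w * slope w $ b" for b w
  define q' where "q' b w v = h w * D2 b w v + h' w v * slope w $ b" for b w v
  have C1_FDg: "Ck_on (Suc 0) UNIV (\<lambda>x. FD g x v)" for v
    using C2_g by simp
  have der_q: "(q b has_derivative q' b w) (at w)" for b w
  proof -
    have "((\<lambda>w. slope w $ b) has_derivative D2 b w) (at w)"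
      unfolding slope_def D2_def[abs_def] vec_lambda_beta
      by (rule has_derivative_compose[OF bounded_linear_imp_has_derivative[OF bounded_linear_emb]
          C1_on_has_derivative[OF C1_FDg UNIV_I]])
    from has_derivative_mult[OF der_h this] show ?thesis
      by (simp add: q_def[abs_def] q'_def[abs_def])
  qed
  have q0: "q b w = 0" if "w \<notin> K'" for b w
    using h0[OF that] by (simp add: q_def)
  have cont_q': "continuous_on K' (\<lambda>w. q' b w v)" for b v
  proof -
    have "continuous_on K' h"
      using der_h has_derivative_continuous continuous_at_imp_continuous_on by blast
    moreover have "continuous_on K' (\<lambda>w. D2 b w v)"
      unfolding D2_def
      by (rule continuous_on_compose2[OF C1_on_continuous_on_FD[OF C1_FDg] cont_emb]) auto
    moreover have "continuous_on K' (\<lambda>w. slope w $ b)"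
      by (intro continuous_on_component continuous_on_slope)
    ultimately show ?thesis
      unfolding q'_def
      by (intro continuous_on_add continuous_on_mult continuous_on_subset[OF cont_h' K'params])
  qed
  have int_q': "integrable lborel (\<lambda>w. q' b w v)" "(LINT w|lborel. q' b w v) = 0" for b v
    by (rule integral_directional_derivative_compact_support[OF der_q K' _ cont_q']; rule q0; assumption)+

  define G where "G w = - s * (conormal (chart w) $ i * FD f (chart w) (axis j 1)
      - conormal (chart w) $ j * FD f (chart w) (axis i 1))" for w
  have N: "conormal (chart w) $ k = 1" "conormal (chart w) $ e l = - slope w $ l" for w l
    by (simp_all add: conormal_def slope_def)
  have cont_G: "continuous_on params G"
  proof -
    have "continuous_on params (\<lambda>w. conormal (chart w) $ i)" for i
      by (cases "i = k") (auto simp: conormal_def intro!: continuous_intros cont_FDg)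
    then show ?thesis
      unfolding G_def[abs_def]
      by (intro continuous_on_mult continuous_on_diff continuous_on_const cont_FDf)
  qed
  have G_eq: "surface_element chart w * tangential_deriv \<Omega> i j f (chart w) = G w" if w: "w \<in> params" for w
  proof -
    let ?c = "- s / norm (conormal (chart w))"
    have x: "chart w \<in> frontier \<Omega>" "chart w \<in> ball p r"
      using chart_in_iff w by auto
    have "tangential_deriv \<Omega> i j f (chart w) = FD f (chart w)
        (unit_normal \<Omega> (chart w) $ i *\<^sub>R axis j 1 - unit_normal \<Omega> (chart w) $ j *\<^sub>R axis i 1)"
      by (rule tangential_deriv_eq[OF x der_f[OF w] refl])
    also have "\<dots> = ?c * (conormal (chart w) $ i * FD f (chart w) (axis j 1)
      - conormal (chart w) $ j * FD f (chart w) (axis i 1))"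
      unfolding unit_normal_eq[OF x] linear_diff[OF lin_f[OF w]] linear_scale[OF lin_f[OF w]]
      by (simp add: algebra_simps)
    finally show ?thesis
      using conormal_nonzero[of "chart w"] by (simp add: norm_conormal[symmetric] G_def)
  qed
  have "integrable lborel (\<lambda>w. indicator params w *\<^sub>R G w) \<and> (LINT w|lborel. indicator params w *\<^sub>R G w) = 0"
  proof -
    \<comment> \<open>If the coordinate \<open>k\<close> is involved, \<open>G\<close> is a partial derivative of \<open>h\<close> up to sign. Otherwise it is
      \<open>\<partial>\<^sub>a(h \<partial>\<^sub>bg) - \<partial>\<^sub>b(h \<partial>\<^sub>ag)\<close> up to sign, the second derivatives of \<open>g\<close> cancelling by symmetry.\<close>
    consider l where "i = k" "j = e l" | l where "j = k" "i = e l" | a b where "i = e a" "j = e b"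
      using ij inv_e(2) by metis
    then show ?thesis
    proof cases
      case 1
      have "(\<lambda>w. indicator params w *\<^sub>R G w) = (\<lambda>w. - s * h' w (axis l 1))"
        using h'_axis h'0 by (auto simp: G_def 1 N indicator_def fun_eq_iff algebra_simps)
      then show ?thesis using int_h' by simp
    next
      case 2
      have "(\<lambda>w. indicator params w *\<^sub>R G w) = (\<lambda>w. s * h' w (axis l 1))"
        using h'_axis h'0 by (auto simp: G_def 2 N indicator_def fun_eq_iff algebra_simps)
      then show ?thesis using int_h' by simp
    next
      case 3
      have sym: "D2 b w (axis a 1) = D2 a w (axis b 1)" for w
        unfolding D2_def emb_axis by (rule symmetric_second_derivative[OF C2_g])
      have "indicator params w *\<^sub>R G w = - s * (q' b w (axis a 1) - q' a w (axis b 1))" for w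
      proof (cases "w \<in> params")
        case True
        have "G w = - s * (slope w $ b * h' w (axis a 1) - slope w $ a * h' w (axis b 1))"
          unfolding h'_axis[OF True] by (simp add: G_def 3 N algebra_simps)
        then show ?thesis using True by (simp add: q'_def sym algebra_simps)
      next
        case False
        then show ?thesis by (simp add: q'_def sym h'0)
      qed
      then show ?thesis using int_q' by simp
    qed
  qed
  note G = this
  from set_integral_surface_measure[OF G_eq cont_G G[THEN conjunct1] F0] G
  show "set_integrable (surface_measure TYPE('m) (frontier \<Omega>)) (frontier \<Omega>) (tangential_deriv \<Omega> i j f)"
    and "(LINT x:frontier \<Omega>|surface_measure TYPE('m) (frontier \<Omega>). tangential_deriv \<Omega> i j f x) = 0"
    by simp_all
qed

end

lemma ex_boundary_chart:
  fixes \<Omega> :: "(real^'n) set"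
  assumes dim: "CARD('n) = Suc CARD('m::{finite,wellorder})"
    and \<Omega>: "smooth_bounded_domain \<Omega>" and p: "p \<in> frontier \<Omega>"
  obtains k g r s and e :: "'m::{finite,wellorder} \<Rightarrow> 'n" where "r > 0" "boundary_chart k e g \<Omega> p r s"
proof -
  have \<Omega>': "open \<Omega>" "smooth_boundary \<Omega>"
    using \<Omega> by (simp_all add: smooth_bounded_domain_def)
  obtain r k s g where c: "r > 0" "s \<in> {-1, 1::real}" "smooth_on UNIV g"
    "\<Omega> \<inter> ball p r = {x \<in> ball p r. s * (x $ k - g (\<chi> i. if i = k then 0 else x $ i)) > 0}"
    using bspec[OF \<Omega>'(2)[unfolded smooth_boundary_def] p] by (elim exE bexE conjE)
  have "card (UNIV :: 'm::_ set) = card (- {k})"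
    using dim by (simp add: Compl_eq_Diff_UNIV card_Diff_singleton)
  then obtain e :: "'m::_ \<Rightarrow> 'n" where e: "bij_betw e UNIV (- {k})"
    using finite_same_card_bij[OF finite_class.finite_UNIV finite] by blast
  have "boundary_chart k e g \<Omega> p r s"
    by unfold_locales (fact e c \<Omega>')+
  then show thesis using that c(1) by blast
qed

lemma tangential_deriv_has_derivative:
  fixes \<Omega> :: "(real^'n) set"
  assumes dim: "CARD('n) = Suc CARD('m::{finite,wellorder})"
    and \<Omega>: "smooth_bounded_domain \<Omega>" and x: "x \<in> frontier \<Omega>"
    and f: "(f has_derivative D) (at x)" and ff: "\<And>y. y \<in> frontier \<Omega> \<Longrightarrow> f' y = f y"
  shows "tangential_deriv \<Omega> i j f' x =
    D (unit_normal \<Omega> x $ i *\<^sub>R axis j 1 - unit_normal \<Omega> x $ j *\<^sub>R axis i 1)"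
proof -
  obtain k g r s and e :: "'m::_ \<Rightarrow> 'n" where c: "r > 0" "boundary_chart k e g \<Omega> x r s"
    by (rule ex_boundary_chart[OF dim \<Omega> x])
  interpret boundary_chart k e g \<Omega> x r s by fact
  show ?thesis
    by (rule tangential_deriv_eq[OF x _ f ff]) (use c in auto)
qed

text \<open>Finitely many bumps supported in graph patches are positive somewhere at each boundary point.
  Divided by their sum \<open>\<sigma>\<close> they form a partition of unity near the boundary, which splits \<open>f\<close> into
  pieces to which the local statement applies.\<close>

theorem integral_tangential_deriv_eq_0:
  fixes \<Omega> :: "(real^'n) set"
  assumes dim: "CARD('n) = Suc CARD('m::{finite,wellorder})"
    and \<Omega>: "smooth_bounded_domain \<Omega>" and ij: "i \<noteq> j"
    and V: "open V" "frontier \<Omega> \<subseteq> V" and f: "Ck_on (Suc 0) V f"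
  shows "(LINT x:frontier \<Omega>|surface_measure TYPE('m) (frontier \<Omega>). tangential_deriv \<Omega> i j f x) = 0"
proof -
  let ?S = "frontier \<Omega>"
  let ?\<mu> = "surface_measure TYPE('m) ?S"
  have "\<forall>p\<in>?S. \<exists>r. r > 0 \<and> (\<exists>k g s. \<exists>e :: 'm::_ \<Rightarrow> 'n. boundary_chart k e g \<Omega> p r s)"
  proof
    fix p assume "p \<in> ?S"
    then obtain k g r s and e :: "'m::_ \<Rightarrow> 'n" where "r > 0" "boundary_chart k e g \<Omega> p r s"
      by (rule ex_boundary_chart[OF dim \<Omega>])
    then show "\<exists>r. r > 0 \<and> (\<exists>k g s. \<exists>e :: 'm::_ \<Rightarrow> 'n. boundary_chart k e g \<Omega> p r s)"
      by blast
  qed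
  from bchoice[OF this] obtain r where
    r: "\<And>p. p \<in> ?S \<Longrightarrow> r p > 0 \<and> (\<exists>k g s. \<exists>e :: 'm::_ \<Rightarrow> 'n. boundary_chart k e g \<Omega> p (r p) s)"
    by blast
  have "compact ?S"
    using \<Omega> by (simp add: smooth_bounded_domain_def compact_frontier_bounded)
  then obtain P where P: "P \<subseteq> ?S" "finite P" "?S \<subseteq> (\<Union>p\<in>P. ball p (r p / 2))"
  proof (rule compactE_image[of ?S ?S "\<lambda>p. ball p (r p / 2)"])
    show "?S \<subseteq> (\<Union>p\<in>?S. ball p (r p / 2))"
      using r by force
  qed auto
  define b where "b p = bump p (r p / 2)" for p
  define \<sigma> where "\<sigma> x = (\<Sum>p\<in>P. b p x)" for x
  define V' where "V' = V \<inter> (\<Union>p\<in>P. ball p (r p / 2))"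
  have V': "open V'" "?S \<subseteq> V'" "V' \<subseteq> V"
    using V P by (auto simp: V'_def)
  have b_pos: "b p x > 0 \<longleftrightarrow> x \<in> ball p (r p / 2)" if "p \<in> P" for p x
    unfolding b_def using r P(1) that by (intro bump_pos_iff) auto
  have \<sigma>: "\<sigma> x > 0" if x: "x \<in> V'" for x
  proof -
    obtain p where "p \<in> P" "x \<in> ball p (r p / 2)" using x by (auto simp: V'_def)
    then show ?thesis
      unfolding \<sigma>_def using P(2) b_pos by (intro sum_pos2[of P p]) (auto simp: b_def bump_nonneg)
  qed
  define F where "F p x = f x * (b p x * inverse (\<sigma> x))" for p x
  have C1_F: "Ck_on (Suc 0) V' (F p)" for p
    unfolding F_def[abs_def] \<sigma>_def[abs_def]
    by (intro C1_on_mult C1_on_inverse C1_on_sum C1_on_subset[OF f V'(3)])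
      (use \<sigma> in \<open>auto simp: b_def \<sigma>_def C1_on_bump less_imp_neq[THEN not_sym] simp del: Ck_on.simps\<close>)
  have F_supp: "F p x = 0" if "p \<in> P" "x \<notin> cball p (r p / 2)" for p x
  proof -
    have "\<not> b p x > 0" using b_pos that by auto
    then have "b p x = 0" using bump_nonneg[of p "r p / 2" x] by (simp add: b_def)
    then show ?thesis by (simp add: F_def)
  qed
  have pieces: "set_integrable ?\<mu> ?S (tangential_deriv \<Omega> i j (F p))"
    "(LINT x:?S|?\<mu>. tangential_deriv \<Omega> i j (F p) x) = 0" if p: "p \<in> P" for p
  proof -
    obtain k g s and e :: "'m::_ \<Rightarrow> 'n" where "boundary_chart k e g \<Omega> p (r p) s"
      using r[of p] P(1) p by blast
    then interpret boundary_chart k e g \<Omega> p "r p" s .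
    have rp: "r p > 0" using r P(1) p by auto
    have K: "compact (cball p (r p / 2))" "cball p (r p / 2) \<subseteq> ball p (r p)"
      using rp by auto
    have F0: "tangential_deriv \<Omega> i j (F p) x = 0" if x: "x \<in> ?S" "x \<notin> ball p (r p)" for x
    proof -
      have "((\<lambda>x. 0 :: real) has_derivative (\<lambda>v. 0)) (at x)" by simp
      then have "(F p has_derivative (\<lambda>v. 0)) (at x)"
        by (rule has_derivative_transform_within_open[of _ _ _ _ "- cball p (r p / 2)"])
          (use F_supp[OF p] x(2) K(2) in auto)
      from tangential_deriv_has_derivative[OF dim \<Omega> x(1) this refl] show ?thesis by simp
    qed
    show "set_integrable ?\<mu> ?S (tangential_deriv \<Omega> i j (F p))"
      "(LINT x:?S|?\<mu>. tangential_deriv \<Omega> i j (F p) x) = 0"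
      by (rule integral_tangential_deriv_in_chart_eq_0[OF ij V'(2) C1_F K F_supp[OF p] F0]; assumption)+
  qed
  have sum_F: "f x = (\<Sum>p\<in>P. F p x)" if "x \<in> V'" for x
  proof -
    have "(\<Sum>p\<in>P. F p x) = f x * (\<sigma> x * inverse (\<sigma> x))"
      by (simp add: F_def \<sigma>_def sum_distrib_left sum_distrib_right)
    then show ?thesis using \<sigma>[OF that] by simp
  qed
  have td: "tangential_deriv \<Omega> i j f x = (\<Sum>p\<in>P. tangential_deriv \<Omega> i j (F p) x)" if x: "x \<in> ?S" for x
  proof -
    have xV': "x \<in> V'" using x V' by auto
    have dF: "(F p has_derivative FD (F p) x) (at x)" for p
      by (rule C1_on_has_derivative[OF C1_F xV'])
    then have "((\<lambda>x. \<Sum>p\<in>P. F p x) has_derivative (\<lambda>v. \<Sum>p\<in>P. FD (F p) x v)) (at x)"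
      by (intro has_derivative_sum)
    then have "(f has_derivative (\<lambda>v. \<Sum>p\<in>P. FD (F p) x v)) (at x)"
      by (rule has_derivative_transform_within_open[OF _ V'(1) xV']) (simp add: sum_F)
    from tangential_deriv_has_derivative[OF dim \<Omega> x this refl]
      tangential_deriv_has_derivative[OF dim \<Omega> x dF refl]
    show ?thesis by simp
  qed
  have "(LINT x:?S|?\<mu>. tangential_deriv \<Omega> i j f x)
      = (LINT x|?\<mu>. (\<Sum>p\<in>P. indicator ?S x *\<^sub>R tangential_deriv \<Omega> i j (F p) x))"
    unfolding set_lebesgue_integral_def
    by (intro Bochner_Integration.integral_cong refl) (auto simp: td indicator_def)
  also have "\<dots> = (\<Sum>p\<in>P. (LINT x:?S|?\<mu>. tangential_deriv \<Omega> i j (F p) x))"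
    unfolding set_lebesgue_integral_def
    using pieces(1) by (intro Bochner_Integration.integral_sum) (simp add: set_integrable_def)
  also have "\<dots> = 0"
    using pieces(2) by simp
  finally show ?thesis .
qed

section \<open>Steady states without flow\<close>

lemma frechet_derivative_cong_open:
  assumes "open W" "x \<in> W" "\<And>y. y \<in> W \<Longrightarrow> f y = g y"
  shows "FD f x = FD g x"
proof -
  have "(f has_derivative D) (at x) \<longleftrightarrow> (g has_derivative D) (at x)" for D
    using assms by (auto intro: has_derivative_transform_within_open[OF _ assms(1,2)])
  then show ?thesis by (simp add: frechet_derivative_def)
qed

lemma grad_pressure_if_velocity_zero:
  assumes \<Omega>: "open \<Omega>" and u: "\<And>x. x \<in> \<Omega> \<Longrightarrow> u x = 0"
    and stokes: "\<And>x. x \<in> \<Omega> \<Longrightarrow> advect u u x - vlaplace u x + grad p x = F x" and x: "x \<in> \<Omega>"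
  shows "grad p x = F x"
proof -
  have FD0: "FD (\<lambda>y. u y $ i) y v = 0" if "y \<in> \<Omega>" for y i v
    using frechet_derivative_cong_open[OF \<Omega> that, of "\<lambda>y. u y $ i" "\<lambda>y. 0"] u by simp
  have "laplace (\<lambda>y. u y $ i) x = 0" for i
  proof -
    have "FD (\<lambda>y. grad (\<lambda>y. u y $ i) y $ l) x v = 0" for l v
      using frechet_derivative_cong_open[OF \<Omega> x, of "\<lambda>y. grad (\<lambda>y. u y $ i) y $ l" "\<lambda>y. 0"] FD0
      by (simp add: grad_def pderiv_at_def)
    then show ?thesis by (simp add: laplace_def diverg_def pderiv_at_def)
  qed
  then have "vlaplace u x = 0" by (simp add: vlaplace_def vec_eq_iff)
  moreover have "advect u u x = 0" unfolding advect_def u[OF x] by (simp add: vec_eq_iff)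
  ultimately show ?thesis using stokes[OF x] by simp
qed

lemma smooth_upto_C1_extension:
  assumes "smooth_upto S f"
  obtains V g where "open V" "S \<subseteq> V" "Ck_on (Suc 0) V g" "\<forall>x\<in>S. g x = f x"
  using assms unfolding smooth_upto_def smooth_on_def by metis

text \<open>Both sides are continuous up to the boundary, as the functions are \<open>C\<^sup>1\<close> on a neighbourhood of
  the closure.\<close>

lemma proportional_gradients_on_closure:
  fixes p q \<Phi> :: "real^'n \<Rightarrow> real"
  assumes V: "closure \<Omega> \<subseteq> V" and C1: "Ck_on (Suc 0) V p" "Ck_on (Suc 0) V q" "Ck_on (Suc 0) V \<Phi>"
    and eq: "\<And>x. x \<in> \<Omega> \<Longrightarrow> grad p x = - (q x *\<^sub>R grad \<Phi> x)" and x: "x \<in> closure \<Omega>"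
  shows "FD p x v = - q x * FD \<Phi> x v"
proof -
  have axis: "FD p x (axis i 1) = - q x * FD \<Phi> x (axis i 1)" for i
  proof -
    have "continuous_on (closure \<Omega>) (\<lambda>x. FD p x (axis i 1) + q x * FD \<Phi> x (axis i 1))"
      using V by (intro continuous_on_add continuous_on_mult C1_on_continuous_on_FD C1_on_continuous_on
          C1_on_subset[OF C1(1)] C1_on_subset[OF C1(2)] C1_on_subset[OF C1(3)])
    moreover have "FD p x (axis i 1) + q x * FD \<Phi> x (axis i 1) = 0" if "x \<in> \<Omega>" for x
      using arg_cong[OF eq[OF that], of "\<lambda>v. v $ i"] by (simp add: grad_def pderiv_at_def)
    ultimately have "FD p x (axis i 1) + q x * FD \<Phi> x (axis i 1) = 0"
      using x by (rule continuous_constant_on_closure)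
    then show ?thesis by simp
  qed
  have xV: "x \<in> V" using V x by blast
  have lin: "linear (FD p x)" "linear (FD \<Phi> x)"
    using C1_on_has_derivative[OF _ xV] C1 has_derivative_linear by blast+
  have v: "v = (\<Sum>i\<in>UNIV. v $ i *\<^sub>R axis i 1)"
    by (metis basis_expansion scalar_mult_eq_scaleR)
  show ?thesis
    by (subst (1 2) v) (simp add: linear_sum[OF lin(1)] linear_sum[OF lin(2)] linear_scale[OF lin(1)]
        linear_scale[OF lin(2)] axis sum_distrib_left mult_ac)
qed

theorem theorem3:
  fixes \<Omega> :: "(real^'n) set"
    and \<gamma>1 \<gamma>2 W c1 c2 \<rho> \<Phi> p :: "real^'n \<Rightarrow> real"
    and u :: "real^'n \<Rightarrow> real^'n"
  assumes "CARD('n) \<in> {2, 3}" and "CARD('n) = Suc CARD('m::{finite,wellorder})"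
    and "smooth_bounded_domain \<Omega>"
    and "smooth_upto (frontier \<Omega>) \<gamma>1" and "smooth_upto (frontier \<Omega>) \<gamma>2"
    and "smooth_upto (frontier \<Omega>) W"
    and "\<And>x. x \<in> frontier \<Omega> \<Longrightarrow> \<gamma>1 x > 0" and "\<And>x. x \<in> frontier \<Omega> \<Longrightarrow> \<gamma>2 x > 0"
    and "smooth_upto (closure \<Omega>) c1" and "smooth_upto (closure \<Omega>) c2"
    and "smooth_upto (closure \<Omega>) \<Phi>" and "smooth_upto (closure \<Omega>) p"
    and "smooth_upto (closure \<Omega>) u"
    and "\<And>x. x \<in> \<Omega> \<Longrightarrow> u x \<bullet> grad c1 x = diverg (\<lambda>y. grad c1 y + c1 y *\<^sub>R grad \<Phi> y) x"
    and "\<And>x. x \<in> \<Omega> \<Longrightarrow> u x \<bullet> grad c2 x = diverg (\<lambda>y. grad c2 y - c2 y *\<^sub>R grad \<Phi> y) x"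
    and "\<And>x. x \<in> \<Omega> \<Longrightarrow> \<rho> x = c1 x - c2 x"
    and "\<And>x. x \<in> \<Omega> \<Longrightarrow> - laplace \<Phi> x = \<rho> x"
    and "\<And>x. x \<in> \<Omega> \<Longrightarrow> advect u u x - vlaplace u x + grad p x = - (\<rho> x *\<^sub>R grad \<Phi> x)"
    and "\<And>x. x \<in> \<Omega> \<Longrightarrow> diverg u x = 0"
    and "\<And>x. x \<in> frontier \<Omega> \<Longrightarrow> c1 x = \<gamma>1 x" and "\<And>x. x \<in> frontier \<Omega> \<Longrightarrow> c2 x = \<gamma>2 x"
    and "\<And>x. x \<in> frontier \<Omega> \<Longrightarrow> \<Phi> x = W x" and "\<And>x. x \<in> frontier \<Omega> \<Longrightarrow> u x = 0"
    and "\<exists>i j. i \<noteq> j \<and>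
      ((LINT x:frontier \<Omega>|surface_measure TYPE('m) (frontier \<Omega>).
          (\<gamma>1 x - \<gamma>2 x) * tangential_deriv \<Omega> i j W x) \<noteq> 0 \<or>
       (LINT x:frontier \<Omega>|surface_measure TYPE('m) (frontier \<Omega>).
          W x * tangential_deriv \<Omega> i j (\<lambda>y. \<gamma>1 y - \<gamma>2 y) x) \<noteq> 0)"
  shows "\<exists>x\<in>\<Omega>. u x \<noteq> 0"
proof (rule ccontr)
  assume "\<not> (\<exists>x\<in>\<Omega>. u x \<noteq> 0)"
  then have u0: "\<And>x. x \<in> \<Omega> \<Longrightarrow> u x = 0" by blast
  note dim = assms(2) and \<Omega> = assms(3)
  have open_\<Omega>: "open \<Omega>" using \<Omega> by (simp add: smooth_bounded_domain_def)
  have sub: "\<Omega> \<subseteq> closure \<Omega>" "frontier \<Omega> \<subseteq> closure \<Omega>"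
    by (simp_all add: closure_subset frontier_def)
  obtain V1 c1' where c1: "open V1" "closure \<Omega> \<subseteq> V1" "Ck_on (Suc 0) V1 c1'" "\<forall>x\<in>closure \<Omega>. c1' x = c1 x"
    by (rule smooth_upto_C1_extension[OF assms(9)])
  obtain V2 c2' where c2: "open V2" "closure \<Omega> \<subseteq> V2" "Ck_on (Suc 0) V2 c2'" "\<forall>x\<in>closure \<Omega>. c2' x = c2 x"
    by (rule smooth_upto_C1_extension[OF assms(10)])
  obtain V3 \<Phi>' where \<Phi>: "open V3" "closure \<Omega> \<subseteq> V3" "Ck_on (Suc 0) V3 \<Phi>'" "\<forall>x\<in>closure \<Omega>. \<Phi>' x = \<Phi> x"
    by (rule smooth_upto_C1_extension[OF assms(11)])
  obtain V4 p' where p: "open V4" "closure \<Omega> \<subseteq> V4" "Ck_on (Suc 0) V4 p'" "\<forall>x\<in>closure \<Omega>. p' x = p x"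
    by (rule smooth_upto_C1_extension[OF assms(12)])
  define V where "V = V1 \<inter> V2 \<inter> V3 \<inter> V4"
  define q where "q x = c1' x + (-1) * c2' x" for x
  have V: "open V" "closure \<Omega> \<subseteq> V" "frontier \<Omega> \<subseteq> V"
    using c1 c2 \<Phi> p sub by (auto simp: V_def)
  have C1: "Ck_on (Suc 0) V q" "Ck_on (Suc 0) V \<Phi>'" "Ck_on (Suc 0) V p'"
    unfolding q_def[abs_def]
    by (intro C1_on_add C1_on_mult C1_on_const C1_on_subset[OF c1(3)] C1_on_subset[OF c2(3)]
        C1_on_subset[OF \<Phi>(3)] C1_on_subset[OF p(3)]; auto simp: V_def)+
  have q_frontier: "\<gamma>1 x - \<gamma>2 x = q x" if "x \<in> frontier \<Omega>" for x
    using that sub c1(4) c2(4) assms(20,21) by (auto simp: q_def)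
  have W_frontier: "W x = \<Phi>' x" if "x \<in> frontier \<Omega>" for x
    using that sub \<Phi>(4) assms(22) by auto
  have "grad p' x = - (q x *\<^sub>R grad \<Phi>' x)" if x: "x \<in> \<Omega>" for x
  proof -
    have "grad p x = - (\<rho> x *\<^sub>R grad \<Phi> x)"
      using grad_pressure_if_velocity_zero[OF open_\<Omega> u0 assms(18) x] .
    moreover have "FD p' x = FD p x" "FD \<Phi>' x = FD \<Phi> x"
      using p(4) \<Phi>(4) sub by (auto intro!: frechet_derivative_cong_open[OF open_\<Omega> x])
    moreover have "\<rho> x = q x"
      using assms(16)[OF x] c1(4) c2(4) sub x by (auto simp: q_def)
    ultimately show ?thesis by (simp add: grad_def pderiv_at_def)
  qed
  note FDp = proportional_gradients_on_closure[OF V(2) C1(3,1,2) this]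
  have d: "(q has_derivative FD q x) (at x)" "(\<Phi>' has_derivative FD \<Phi>' x) (at x)"
      "(p' has_derivative FD p' x) (at x)" if "x \<in> frontier \<Omega>" for x
    using that V(3) C1 C1_on_has_derivative by blast+
  let ?\<mu> = "surface_measure TYPE('m) (frontier \<Omega>)"
  note td = tangential_deriv_has_derivative[OF dim \<Omega>]
  from assms(24) obtain i j where ij: "i \<noteq> j" and nonzero:
     "(LINT x:frontier \<Omega>|?\<mu>. (\<gamma>1 x - \<gamma>2 x) * tangential_deriv \<Omega> i j W x) \<noteq> 0 \<or>
      (LINT x:frontier \<Omega>|?\<mu>. W x * tangential_deriv \<Omega> i j (\<lambda>y. \<gamma>1 y - \<gamma>2 y) x) \<noteq> 0"
    by blast
  note exact = integral_tangential_deriv_eq_0[OF dim \<Omega> _ V(1,3)]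
  \<comment> \<open>Exchanging \<open>i\<close> and \<open>j\<close> on the right absorbs the sign in \<open>\<nabla>p = - \<rho> \<nabla>\<Phi>\<close>.\<close>
  have "(\<gamma>1 x - \<gamma>2 x) * tangential_deriv \<Omega> i j W x = tangential_deriv \<Omega> j i p' x"
    if x: "x \<in> frontier \<Omega>" for x
  proof -
    define t where "t = unit_normal \<Omega> x $ i *\<^sub>R axis j 1 - unit_normal \<Omega> x $ j *\<^sub>R (axis i 1 :: real^'n)"
    have "tangential_deriv \<Omega> i j W x = FD \<Phi>' x t"
      unfolding t_def by (rule td[OF x d(2)[OF x]]) (rule W_frontier)
    moreover have "tangential_deriv \<Omega> j i p' x = FD p' x (- t)"
      unfolding t_def minus_diff_eq by (rule td[OF x d(3)[OF x] refl])
    moreover have "FD p' x (- t) = q x * FD \<Phi>' x t"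
      using FDp[of x "- t"] sub x linear_neg[OF has_derivative_linear[OF d(2)[OF x]]] by auto
    ultimately show ?thesis using q_frontier[OF x] by simp
  qed
  then have "(LINT x:frontier \<Omega>|?\<mu>. (\<gamma>1 x - \<gamma>2 x) * tangential_deriv \<Omega> i j W x)
     = (LINT x:frontier \<Omega>|?\<mu>. tangential_deriv \<Omega> j i p' x)"
    unfolding set_lebesgue_integral_def by (intro Bochner_Integration.integral_cong) (auto simp: indicator_def)
  also have "\<dots> = 0"
    using ij C1(3) by (intro exact) auto
  finally have first: "(LINT x:frontier \<Omega>|?\<mu>. (\<gamma>1 x - \<gamma>2 x) * tangential_deriv \<Omega> i j W x) = 0" .
  \<comment> \<open>By the product rule \<open>W \<tau>(\<gamma>1 - \<gamma>2) = \<tau>(\<rho>\<Phi>) - \<rho> \<tau>\<Phi>\<close>, and \<open>- \<rho> \<tau>\<Phi> = \<tau>p\<close>.\<close>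
  define Q where "Q x = q x * \<Phi>' x + p' x" for x
  have C1_Q: "Ck_on (Suc 0) V Q"
    unfolding Q_def[abs_def] by (intro C1_on_add C1_on_mult C1)
  have "W x * tangential_deriv \<Omega> i j (\<lambda>y. \<gamma>1 y - \<gamma>2 y) x = tangential_deriv \<Omega> i j Q x"
    if x: "x \<in> frontier \<Omega>" for x
  proof -
    define t where "t = unit_normal \<Omega> x $ i *\<^sub>R axis j 1 - unit_normal \<Omega> x $ j *\<^sub>R (axis i 1 :: real^'n)"
    have dQ: "(Q has_derivative (\<lambda>v. q x * FD \<Phi>' x v + FD q x v * \<Phi>' x + FD p' x v)) (at x)"
      unfolding Q_def[abs_def] by (intro has_derivative_add has_derivative_mult d x)
    have "tangential_deriv \<Omega> i j (\<lambda>y. \<gamma>1 y - \<gamma>2 y) x = FD q x t"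
      unfolding t_def by (rule td[OF x d(1)[OF x]]) (rule q_frontier)
    moreover have "tangential_deriv \<Omega> i j Q x = q x * FD \<Phi>' x t + FD q x t * \<Phi>' x + FD p' x t"
      unfolding t_def by (rule td[OF x dQ refl])
    ultimately show ?thesis using W_frontier[OF x] FDp[of x t] sub x by auto
  qed
  then have "(LINT x:frontier \<Omega>|?\<mu>. W x * tangential_deriv \<Omega> i j (\<lambda>y. \<gamma>1 y - \<gamma>2 y) x)
     = (LINT x:frontier \<Omega>|?\<mu>. tangential_deriv \<Omega> i j Q x)"
    unfolding set_lebesgue_integral_def by (intro Bochner_Integration.integral_cong) (auto simp: indicator_def)
  also have "\<dots> = 0"
    using ij C1_Q by (intro exact) auto
  finally show False
    using first nonzero by blast
qed

end
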